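(* Let $k$ be a field with $\operatorname{char}(k)\ne 2$, let $S$ be a polynomial ring over $k$ in finitely many variables, and let $I\subseteq S$ be a homogeneous ideal. The following are equivalent: (a) $I$ is radical; (b) the Rees-like algebra $\mathcal{RL}(I)=S[It,t^2]\subseteq S[t]$ is seminormal; (c) $\mathcal{RL}(I)$ is weakly normal.
   Context: For a finite extension $A\subset B$ of reduced rings, a subextension $A\subset C\subset B$ is called subintegral if $A\subset C$ is integral, induces a bijection on spectra, and induces isomorphisms on residue fields at all points; it is called weakly subintegral if $A\subset C$ is integral, induces a bijection on spectra, and all residue field extensions are purely inseparable. Let $A^{\mathrm N}$ be the normalization of $A$. There is a unique largest subintegral subextension $A\subset A^{\mathrm{SN}}\subset A^{\mathrm N}$ and a unique largest weakly subintegral subextension $A\subset A^{\mathrm{WN}}\subset A^{\mathrm N}$. The ring $A$ is seminormal if $A=A^{\mathrm{SN}}$ and weakly normal if $A=A^{\mathrm{WN}}$. *)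

theory Defs
  imports
    "HOL-Algebra.Algebra"
    "HOL-Algebra.Algebraic_Closure_Type"
    "HOL-Library.Poly_Mapping"
begin

section \<open>Total rings of fractions\<close>

definition nonzerodivisors :: "('a, 'b) ring_scheme \<Rightarrow> 'a set" where
  "nonzerodivisors R =
     {s \<in> carrier R. \<forall>a \<in> carrier R. a \<otimes>\<^bsub>R\<^esub> s = \<zero>\<^bsub>R\<^esub> \<longrightarrow> a = \<zero>\<^bsub>R\<^esub>}"

definition fraction_rel :: "('a, 'b) ring_scheme \<Rightarrow> (('a \<times> 'a) \<times> ('a \<times> 'a)) set" where
  "fraction_rel R =
     {((a, s), (b, t)). a \<in> carrier R \<and> b \<in> carrier R \<and>
        s \<in> nonzerodivisors R \<and> t \<in> nonzerodivisors R \<and> a \<otimes>\<^bsub>R\<^esub> t = b \<otimes>\<^bsub>R\<^esub> s}"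

definition fraction :: "('a, 'b) ring_scheme \<Rightarrow> 'a \<Rightarrow> 'a \<Rightarrow> ('a \<times> 'a) set" where
  "fraction R a s = fraction_rel R `` {(a, s)}"

definition total_fractions :: "('a, 'b) ring_scheme \<Rightarrow> ('a \<times> 'a) set ring" where
  "total_fractions R =
     \<lparr> carrier = (carrier R \<times> nonzerodivisors R) // fraction_rel R,
       monoid.mult = (\<lambda>p q. \<Union>(a, s) \<in> p. \<Union>(b, t) \<in> q. fraction R (a \<otimes>\<^bsub>R\<^esub> b) (s \<otimes>\<^bsub>R\<^esub> t)),
       one = fraction R \<one>\<^bsub>R\<^esub> \<one>\<^bsub>R\<^esub>,
       ring.zero = fraction R \<zero>\<^bsub>R\<^esub> \<one>\<^bsub>R\<^esub>,
       add = (\<lambda>p q. \<Union>(a, s) \<in> p. \<Union>(b, t) \<in> q.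
                fraction R (a \<otimes>\<^bsub>R\<^esub> t \<oplus>\<^bsub>R\<^esub> b \<otimes>\<^bsub>R\<^esub> s) (s \<otimes>\<^bsub>R\<^esub> t)) \<rparr>"

definition fraction_embed :: "('a, 'b) ring_scheme \<Rightarrow> 'a \<Rightarrow> ('a \<times> 'a) set" where
  "fraction_embed R a = fraction R a \<one>\<^bsub>R\<^esub>"


section \<open>Integral elements and normalization\<close>

text \<open>
  The list \<open>\<one> # p\<close> holds the coefficients of a monic polynomial over \<open>K\<close>, leading
  coefficient first.
\<close>

definition integral_over :: "('a, 'b) ring_scheme \<Rightarrow> 'a set \<Rightarrow> 'a \<Rightarrow> bool" where
  "integral_over R K x \<longleftrightarrow>
     x \<in> carrier R \<and> (\<exists>p. set p \<subseteq> K \<and> ring.eval R (\<one>\<^bsub>R\<^esub> # p) x = \<zero>\<^bsub>R\<^esub>)"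

definition normalization :: "('a, 'b) ring_scheme \<Rightarrow> ('a \<times> 'a) set ring" where
  "normalization A = (total_fractions A)
     \<lparr> carrier := {x. integral_over (total_fractions A) (fraction_embed A ` carrier A) x} \<rparr>"


section \<open>Spectra and residue fields\<close>

definition Spec :: "('a, 'b) ring_scheme \<Rightarrow> 'a set set" where
  "Spec R = {P. primeideal P R}"

definition residue_field :: "('a, 'b) ring_scheme \<Rightarrow> 'a set \<Rightarrow> ('a set \<times> 'a set) set ring" where
  "residue_field R P = total_fractions (R Quot P)"

text \<open>
  For a subring \<open>A\<close> of \<open>C\<close>, a prime \<open>Q\<close> of \<open>C\<close> and \<open>P = Q \<inter> A\<close>, the sum \<open>Q + U\<close> of \<open>Q\<close> and
  a coset \<open>U = P + a\<close> is the coset \<open>Q + a\<close>. Hence the following function is the map that the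
  inclusion induces from the residue field of \<open>P\<close> to that of \<open>Q\<close>: it sends \<open>a / s\<close> to \<open>a / s\<close>.
\<close>

definition residue_map ::
    "('a, 'b) ring_scheme \<Rightarrow> 'a set \<Rightarrow> ('a set \<times> 'a set) set \<Rightarrow> ('a set \<times> 'a set) set" where
  "residue_map C Q p =
     (\<Union>(U, V) \<in> p. fraction (C Quot Q) (Q <+>\<^bsub>C\<^esub> U) (Q <+>\<^bsub>C\<^esub> V))"

text \<open>
  The additive order of \<open>\<one>\<close> is \<open>0\<close> if it is infinite, so this is \<open>1\<close> in characteristic zero
  and the characteristic otherwise.
\<close>

definition char_exponent :: "('a, 'b) ring_scheme \<Rightarrow> nat" where
  "char_exponent K = max 1 (group.ord (add_monoid K) \<one>\<^bsub>K\<^esub>)"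

definition purely_inseparable ::
    "('a, 'c) ring_scheme \<Rightarrow> ('b, 'd) ring_scheme \<Rightarrow> ('a \<Rightarrow> 'b) \<Rightarrow> bool" where
  "purely_inseparable K L \<phi> \<longleftrightarrow>
     \<phi> \<in> ring_hom K L \<and>
     (\<forall>x \<in> carrier L. \<exists>n. x [^]\<^bsub>L\<^esub> (char_exponent K ^ n) \<in> \<phi> ` carrier K)"


section \<open>Seminormal rings and weakly normal rings\<close>

definition integral_Spec_bij :: "('a, 'b) ring_scheme \<Rightarrow> 'a set \<Rightarrow> 'a set \<Rightarrow> bool" where
  "integral_Spec_bij B A C \<longleftrightarrow>
     subring A B \<and> subring C B \<and> A \<subseteq> C \<and>
     (\<forall>x \<in> C. integral_over B A x) \<and>
     bij_betw (\<lambda>Q. Q \<inter> A) (Spec (B\<lparr>carrier := C\<rparr>)) (Spec (B\<lparr>carrier := A\<rparr>))"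

definition subintegral :: "('a, 'b) ring_scheme \<Rightarrow> 'a set \<Rightarrow> 'a set \<Rightarrow> bool" where
  "subintegral B A C \<longleftrightarrow>
     integral_Spec_bij B A C \<and>
     (\<forall>Q \<in> Spec (B\<lparr>carrier := C\<rparr>).
        residue_map (B\<lparr>carrier := C\<rparr>) Q
          \<in> ring_iso (residue_field (B\<lparr>carrier := A\<rparr>) (Q \<inter> A))
                     (residue_field (B\<lparr>carrier := C\<rparr>) Q))"

definition weakly_subintegral :: "('a, 'b) ring_scheme \<Rightarrow> 'a set \<Rightarrow> 'a set \<Rightarrow> bool" where
  "weakly_subintegral B A C \<longleftrightarrow>
     integral_Spec_bij B A C \<and>
     (\<forall>Q \<in> Spec (B\<lparr>carrier := C\<rparr>).
        purely_inseparable (residue_field (B\<lparr>carrier := A\<rparr>) (Q \<inter> A))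
                           (residue_field (B\<lparr>carrier := C\<rparr>) Q)
                           (residue_map (B\<lparr>carrier := C\<rparr>) Q))"

definition seminormalization :: "('a, 'b) ring_scheme \<Rightarrow> ('a \<times> 'a) set set" where
  "seminormalization A =
     (GREATEST C. subintegral (normalization A) (fraction_embed A ` carrier A) C)"

definition weak_normalization :: "('a, 'b) ring_scheme \<Rightarrow> ('a \<times> 'a) set set" where
  "weak_normalization A =
     (GREATEST C. weakly_subintegral (normalization A) (fraction_embed A ` carrier A) C)"

definition seminormal :: "('a, 'b) ring_scheme \<Rightarrow> bool" where
  "seminormal A \<longleftrightarrow> fraction_embed A ` carrier A = seminormalization A"

definition weakly_normal :: "('a, 'b) ring_scheme \<Rightarrow> bool" where
  "weakly_normal A \<longleftrightarrow> fraction_embed A ` carrier A = weak_normalization A"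


section \<open>Polynomial rings, homogeneous ideals and Rees-like algebras\<close>

text \<open>
  The type \<open>'k mpoly\<close> has variables indexed by all natural numbers; \<open>mpoly_ring n\<close> is the
  polynomial ring in the \<open>n\<close> variables with index below \<open>n\<close>, where \<open>n = 0\<close> is allowed.
\<close>

type_synonym 'k mpoly = "(nat \<Rightarrow>\<^sub>0 nat) \<Rightarrow>\<^sub>0 'k"

definition mpoly_ring :: "nat \<Rightarrow> 'k::comm_ring_1 mpoly ring" where
  "mpoly_ring n =
     ring_of_type_algebra
       \<lparr> carrier := {f. \<forall>m \<in> Poly_Mapping.keys f. Poly_Mapping.keys m \<subseteq> {..<n}} \<rparr>"

definition monomial_degree :: "(nat \<Rightarrow>\<^sub>0 nat) \<Rightarrow> nat" where
  "monomial_degree m = (\<Sum>i \<in> Poly_Mapping.keys m. Poly_Mapping.lookup m i)"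

definition homogeneous :: "'k::comm_ring_1 mpoly \<Rightarrow> bool" where
  "homogeneous f \<longleftrightarrow> (\<exists>d. \<forall>m \<in> Poly_Mapping.keys f. monomial_degree m = d)"

definition homogeneous_ideal :: "nat \<Rightarrow> 'k::comm_ring_1 mpoly set \<Rightarrow> bool" where
  "homogeneous_ideal n I \<longleftrightarrow>
     (\<exists>H \<subseteq> carrier (mpoly_ring n). (\<forall>f \<in> H. homogeneous f) \<and> I = genideal (mpoly_ring n) H)"

definition ideal_radical :: "('a, 'b) ring_scheme \<Rightarrow> 'a set \<Rightarrow> 'a set" where
  "ideal_radical R I = {f \<in> carrier R. \<exists>n::nat. n > 0 \<and> f [^]\<^bsub>R\<^esub> n \<in> I}"

definition mpoly_ring_t :: "nat \<Rightarrow> 'k::comm_ring_1 mpoly poly ring" where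
  "mpoly_ring_t n =
     ring_of_type_algebra \<lparr> carrier := {p. \<forall>i. poly.coeff p i \<in> carrier (mpoly_ring n)} \<rparr>"

text \<open>
  In \<open>S[t]\<close>, represented by type \<open>poly\<close>, the elements \<open>f\<close>, \<open>f t\<close> and \<open>t\<^sup>2\<close> are \<open>[:f:]\<close>,
  \<open>[:0, f:]\<close> and \<open>[:0, 0, 1:]\<close>.
\<close>

definition Rees_like :: "nat \<Rightarrow> 'k::comm_ring_1 mpoly set \<Rightarrow> 'k mpoly poly ring" where
  "Rees_like n I = (mpoly_ring_t n)
     \<lparr> carrier := generate_ring (mpoly_ring_t n)
         ((\<lambda>f. [:f:]) ` carrier (mpoly_ring n) \<union> (\<lambda>f. [:0, f:]) ` I \<union> {[:0, 0, 1:]}) \<rparr>"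

end

theory Submission
  imports Defs
begin

text \<open>
  Let \<open>S\<close> be the polynomial ring and \<open>A = S[It, t\<^sup>2]\<close>, the ring of all polynomials in \<open>t\<close> whose odd
  coefficients lie in \<open>I\<close>. If \<open>I \<noteq> 0\<close>, then \<open>A\<close> and \<open>S[t]\<close> have the same fractions and the
  normalization of \<open>A\<close> is \<open>S[t]\<close>; if \<open>I = 0\<close>, then \<open>A = S[t\<^sup>2]\<close> is normal. In either case the
  normalization \<open>R\<close> has the involution \<open>\<sigma>: t \<mapsto> -t\<close>, and \<open>J = I S[t]\<close> is an ideal of \<open>R\<close> that lies in
  \<open>A\<close>. The claim is that \<open>A + rad J\<close>, with the radical taken in \<open>R\<close>, is the greatest subintegral and
  also the greatest weakly subintegral extension of \<open>A\<close> in \<open>R\<close>. Then both seminormality and weak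
  normality mean \<open>rad J \<subseteq> A\<close>. Looking at the elements \<open>g t\<close> with \<open>g\<^sup>m \<in> I\<close>, this says that \<open>I\<close> is
  radical (\<open>radical_subset_A_iff\<close>).

  The extension \<open>A \<subseteq> A + rad J\<close> is subintegral (locale \<open>conductor_extension\<close>): at a prime that does
  not contain \<open>J\<close> the two rings agree, since \<open>J\<close> multiplies \<open>R\<close> into \<open>A\<close>; at a prime that contains \<open>J\<close>
  one only adds elements that vanish in its residue field.

  Conversely let \<open>C\<close> be weakly subintegral over \<open>A\<close>. As even polynomials lie in \<open>A\<close>, it suffices to
  treat an odd element \<open>u \<in> C\<close>. Suppose that \<open>u\<close> is not nilpotent modulo \<open>J\<close> and take a prime
  \<open>H \<supseteq> J\<close> of \<open>R\<close> that avoids \<open>u\<close>. Since \<open>\<sigma>\<close> acts trivially on \<open>A / J\<close>, it fixes \<open>H \<inter> A\<close> and hence the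
  unique prime \<open>Q\<close> of \<open>C\<close> over it. It acts trivially on the residue field of \<open>H \<inter> A\<close>, which contains
  \<open>u\<^sup>q\<close> for some power \<open>q\<close> of the characteristic exponent. That exponent is odd as \<open>2\<close> is invertible,
  so \<open>u\<^sup>q\<close> is its own negative and vanishes at \<open>Q\<close>; but \<open>u\<^sup>2 \<in> A\<close> lies outside \<open>H\<close>
  (\<open>weakly_subintegral_odd_nilpotent\<close>).

  The normality of \<open>S[t]\<close> comes from complete integral closedness, which is proved by cancelling
  leading terms: if \<open>q\<^sup>n\<close> divides \<open>d p\<^sup>n\<close> for all \<open>n\<close>, then the leading term of \<open>q\<close> divides that of \<open>p\<close>
  (\<open>completely_integrally_closed_mpoly_ring\<close>, \<open>completely_integrally_closed_polys_over\<close>).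
\<close>

section \<open>Arithmetic in total rings of fractions\<close>

context cring
begin

lemma nonzerodivisorsD:
  assumes "s \<in> nonzerodivisors R"
  shows "s \<in> carrier R"
    and "\<And>a. \<lbrakk>a \<in> carrier R; a \<otimes> s = \<zero>\<rbrakk> \<Longrightarrow> a = \<zero>"
  using assms by (auto simp: nonzerodivisors_def)

lemma one_nonzerodivisor: "\<one> \<in> nonzerodivisors R"
  by (simp add: nonzerodivisors_def)

lemma nonzerodivisors_mult:
  assumes "s \<in> nonzerodivisors R" "t \<in> nonzerodivisors R"
  shows "s \<otimes> t \<in> nonzerodivisors R"
proof -
  note s = nonzerodivisorsD[OF assms(1)] and t = nonzerodivisorsD[OF assms(2)]
  have "a = \<zero>" if "a \<in> carrier R" "a \<otimes> (s \<otimes> t) = \<zero>" for a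
  proof -
    have "(a \<otimes> s) \<otimes> t = \<zero>" using that s(1) t(1) by (simp add: m_assoc)
    then have "a \<otimes> s = \<zero>" by (rule t(2)[rotated]) (simp add: that(1) s(1))
    then show "a = \<zero>" by (rule s(2)[OF that(1)])
  qed
  then show ?thesis using s(1) t(1) by (simp add: nonzerodivisors_def)
qed

lemma nonzerodivisors_cancel:
  assumes "s \<in> nonzerodivisors R" "a \<in> carrier R" "b \<in> carrier R" "a \<otimes> s = b \<otimes> s"
  shows "a = b"
proof -
  note s = nonzerodivisorsD[OF assms(1)]
  have "(a \<ominus> b) \<otimes> s = a \<otimes> s \<ominus> b \<otimes> s"
    using s(1) assms(2,3) by algebra
  also have "\<dots> = \<zero>" using assms s(1) by (simp add: r_right_minus_eq)
  finally have "a \<ominus> b = \<zero>" by (rule s(2)[rotated]) (simp add: assms(2,3))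
  then show ?thesis using assms by simp
qed

lemma equiv_fraction_rel:
  "equiv (carrier R \<times> nonzerodivisors R) (fraction_rel R)"
proof (rule equivI)
  show "refl_on (carrier R \<times> nonzerodivisors R) (fraction_rel R)"
    by (auto simp: refl_on_def fraction_rel_def)
  show "sym (fraction_rel R)"
    by (auto simp: sym_def fraction_rel_def)
  show "trans (fraction_rel R)"
  proof (rule transI, clarsimp simp: fraction_rel_def)
    fix a s b t c u
    assume c: "a \<in> carrier R" "b \<in> carrier R" "c \<in> carrier R"
      and n: "s \<in> nonzerodivisors R" "t \<in> nonzerodivisors R" "u \<in> nonzerodivisors R"
      and e: "a \<otimes> t = b \<otimes> s" "b \<otimes> u = c \<otimes> t"
    note n' = n[THEN nonzerodivisorsD(1)]
    have "(a \<otimes> u) \<otimes> t = (a \<otimes> t) \<otimes> u" using c n' by (simp add: m_ac)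
    also have "\<dots> = (b \<otimes> u) \<otimes> s" unfolding e(1) using c n' by (simp add: m_ac)
    also have "\<dots> = (c \<otimes> s) \<otimes> t" unfolding e(2) using c n' by (simp add: m_ac)
    finally have "(a \<otimes> u) \<otimes> t = (c \<otimes> s) \<otimes> t" .
    then show "a \<otimes> u = c \<otimes> s"
      by (rule nonzerodivisors_cancel[OF n(2) m_closed[OF c(1) n'(3)] m_closed[OF c(3) n'(1)]])
  qed
  show "fraction_rel R \<subseteq> (carrier R \<times> nonzerodivisors R) \<times> carrier R \<times> nonzerodivisors R"
    by (auto simp: fraction_rel_def)
qed

lemma fraction_eq_iff:
  assumes "a \<in> carrier R" "b \<in> carrier R" "s \<in> nonzerodivisors R" "t \<in> nonzerodivisors R"
  shows "fraction R a s = fraction R b t \<longleftrightarrow> a \<otimes> t = b \<otimes> s"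
  unfolding fraction_def
  using eq_equiv_class_iff[OF equiv_fraction_rel, of "(a, s)" "(b, t)"] assms
  by (auto simp: fraction_rel_def)

lemma fraction_in_carrier [intro]:
  assumes "a \<in> carrier R" "s \<in> nonzerodivisors R"
  shows "fraction R a s \<in> carrier (total_fractions R)"
  using assms by (auto simp: total_fractions_def fraction_def intro!: quotientI)

lemma total_fractionsE:
  assumes "x \<in> carrier (total_fractions R)"
  obtains a s where "a \<in> carrier R" "s \<in> nonzerodivisors R" "x = fraction R a s"
  using assms by (auto simp: total_fractions_def fraction_def elim!: quotientE)

lemma mem_fractionD:
  assumes "(b, t) \<in> fraction R a s"
  shows "b \<in> carrier R" "t \<in> nonzerodivisors R" "a \<otimes> t = b \<otimes> s"
  using assms by (auto simp: fraction_def fraction_rel_def)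

lemma mem_fraction_self:
  assumes "a \<in> carrier R" "s \<in> nonzerodivisors R"
  shows "(a, s) \<in> fraction R a s"
  using assms by (auto simp: fraction_def fraction_rel_def)

text \<open>
  The operations on fractions are unions over all representatives; such a union collapses as soon
  as its body does not depend on the representative.
\<close>

lemma UN_fraction:
  assumes "a \<in> carrier R" "s \<in> nonzerodivisors R"
    and "\<And>b t. \<lbrakk>b \<in> carrier R; t \<in> nonzerodivisors R; a \<otimes> t = b \<otimes> s\<rbrakk> \<Longrightarrow> F b t = c"
  shows "(\<Union>(b, t) \<in> fraction R a s. F b t) = c"
proof -
  have F: "(case p of (b, t) \<Rightarrow> F b t) = c" if "p \<in> fraction R a s" for p
    using that assms(3) mem_fractionD by (cases p) simp
  have "fraction R a s \<noteq> {}" using mem_fraction_self[OF assms(1,2)] by blast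
  then show ?thesis using F by simp
qed

lemma fraction_mult:
  assumes "a \<in> carrier R" "b \<in> carrier R" "s \<in> nonzerodivisors R" "t \<in> nonzerodivisors R"
  shows "fraction R a s \<otimes>\<^bsub>total_fractions R\<^esub> fraction R b t = fraction R (a \<otimes> b) (s \<otimes> t)"
proof -
  note d = nonzerodivisorsD(1)
  have "fraction R (a' \<otimes> b') (s' \<otimes> t') = fraction R (a \<otimes> b) (s \<otimes> t)"
    if "a' \<in> carrier R" "s' \<in> nonzerodivisors R" "a \<otimes> s' = a' \<otimes> s"
      "b' \<in> carrier R" "t' \<in> nonzerodivisors R" "b \<otimes> t' = b' \<otimes> t" for a' b' s' t'
  proof -
    note c = assms(1,2) that(1,4) d[OF assms(3)] d[OF assms(4)] d[OF that(2)] d[OF that(5)]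
    have "(a' \<otimes> b') \<otimes> (s \<otimes> t) = (a' \<otimes> s) \<otimes> (b' \<otimes> t)"
      using c by (simp add: m_ac)
    also have "\<dots> = (a \<otimes> s') \<otimes> (b \<otimes> t')" using that by simp
    also have "\<dots> = (a \<otimes> b) \<otimes> (s' \<otimes> t')"
      using c by (simp add: m_ac)
    finally show ?thesis
      by (rule iffD2[OF fraction_eq_iff, rotated -1])
        (simp_all add: c nonzerodivisors_mult assms(3,4) that(2,5))
  qed
  note * = this
  show ?thesis
    unfolding total_fractions_def monoid.select_convs ring.select_convs
    by (rule UN_fraction[OF assms(1,3)], rule UN_fraction[OF assms(2,4)], rule *)
qed

lemma fraction_add:
  assumes "a \<in> carrier R" "b \<in> carrier R" "s \<in> nonzerodivisors R" "t \<in> nonzerodivisors R"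
  shows "fraction R a s \<oplus>\<^bsub>total_fractions R\<^esub> fraction R b t =
    fraction R (a \<otimes> t \<oplus> b \<otimes> s) (s \<otimes> t)"
proof -
  note d = nonzerodivisorsD(1)
  have "fraction R (a' \<otimes> t' \<oplus> b' \<otimes> s') (s' \<otimes> t') = fraction R (a \<otimes> t \<oplus> b \<otimes> s) (s \<otimes> t)"
    if "a' \<in> carrier R" "s' \<in> nonzerodivisors R" "a \<otimes> s' = a' \<otimes> s"
      "b' \<in> carrier R" "t' \<in> nonzerodivisors R" "b \<otimes> t' = b' \<otimes> t" for a' b' s' t'
  proof -
    note c = assms(1,2) that(1,4) d[OF assms(3)] d[OF assms(4)] d[OF that(2)] d[OF that(5)]
    have "(a' \<otimes> t' \<oplus> b' \<otimes> s') \<otimes> (s \<otimes> t) =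
        (a' \<otimes> s) \<otimes> (t' \<otimes> t) \<oplus> (b' \<otimes> t) \<otimes> (s' \<otimes> s)"
      using c by algebra
    also have "\<dots> = (a \<otimes> s') \<otimes> (t' \<otimes> t) \<oplus> (b \<otimes> t') \<otimes> (s' \<otimes> s)" using that by simp
    also have "\<dots> = (a \<otimes> t \<oplus> b \<otimes> s) \<otimes> (s' \<otimes> t')"
      using c by algebra
    finally show ?thesis
      by (rule iffD2[OF fraction_eq_iff, rotated -1])
        (simp_all add: c nonzerodivisors_mult assms(3,4) that(2,5))
  qed
  note * = this
  show ?thesis
    unfolding total_fractions_def monoid.select_convs ring.select_convs
    by (rule UN_fraction[OF assms(1,3)], rule UN_fraction[OF assms(2,4)], rule *)
qed

lemma fraction_one: "\<one>\<^bsub>total_fractions R\<^esub> = fraction R \<one> \<one>"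
  and fraction_zero: "\<zero>\<^bsub>total_fractions R\<^esub> = fraction R \<zero> \<one>"
  by (simp_all add: total_fractions_def)

lemma cring_total_fractions: "cring (total_fractions R)"
proof (rule cringI)
  note d = nonzerodivisorsD(1)
  note simps = fraction_add fraction_mult fraction_one fraction_zero nonzerodivisors_mult
    one_nonzerodivisor fraction_eq_iff d
  show "abelian_group (total_fractions R)"
  proof (rule abelian_groupI)
    fix x y z
    assume xc: "x \<in> carrier (total_fractions R)" and yc: "y \<in> carrier (total_fractions R)"
      and zc: "z \<in> carrier (total_fractions R)"
    from xc obtain a s where x: "x = fraction R a s"
      and cx: "a \<in> carrier R" "s \<in> nonzerodivisors R" by (rule total_fractionsE)
    from yc obtain b t where y: "y = fraction R b t"
      and cy: "b \<in> carrier R" "t \<in> nonzerodivisors R" by (rule total_fractionsE)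
    from zc obtain c u where z: "z = fraction R c u"
      and cz: "c \<in> carrier R" "u \<in> nonzerodivisors R" by (rule total_fractionsE)
    show "x \<oplus>\<^bsub>total_fractions R\<^esub> y \<oplus>\<^bsub>total_fractions R\<^esub> z =
        x \<oplus>\<^bsub>total_fractions R\<^esub> (y \<oplus>\<^bsub>total_fractions R\<^esub> z)"
      using cx cx(2)[THEN d] cy cy(2)[THEN d] cz cz(2)[THEN d] unfolding x y z
      by (simp add: fraction_add nonzerodivisors_mult l_distr r_distr m_ac a_ac)
  next
    fix x y
    assume xc: "x \<in> carrier (total_fractions R)" and yc: "y \<in> carrier (total_fractions R)"
    from xc obtain a s where x: "x = fraction R a s"
      and cx: "a \<in> carrier R" "s \<in> nonzerodivisors R" by (rule total_fractionsE)
    from yc obtain b t where y: "y = fraction R b t"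
      and cy: "b \<in> carrier R" "t \<in> nonzerodivisors R" by (rule total_fractionsE)
    show "x \<oplus>\<^bsub>total_fractions R\<^esub> y \<in> carrier (total_fractions R)"
      using cx cx(2)[THEN d] cy cy(2)[THEN d] unfolding x y by (auto simp: simps intro!: fraction_in_carrier)
    show "x \<oplus>\<^bsub>total_fractions R\<^esub> y = y \<oplus>\<^bsub>total_fractions R\<^esub> x"
      using cx cx(2)[THEN d] cy cy(2)[THEN d] unfolding x y by (simp add: fraction_add m_ac a_ac)
  next
    fix x assume xc: "x \<in> carrier (total_fractions R)"
    from xc obtain a s where x: "x = fraction R a s"
      and cx: "a \<in> carrier R" "s \<in> nonzerodivisors R" by (rule total_fractionsE)
    show "\<zero>\<^bsub>total_fractions R\<^esub> \<oplus>\<^bsub>total_fractions R\<^esub> x = x"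
      using cx cx(2)[THEN d] unfolding x by (simp add: simps)
    have "fraction R (\<ominus> a) s \<oplus>\<^bsub>total_fractions R\<^esub> x = \<zero>\<^bsub>total_fractions R\<^esub>"
      using cx cx(2)[THEN d] unfolding x by (simp add: simps l_distr[symmetric] l_neg)
    moreover have "fraction R (\<ominus> a) s \<in> carrier (total_fractions R)"
      using cx by auto
    ultimately show "\<exists>y\<in>carrier (total_fractions R).
        y \<oplus>\<^bsub>total_fractions R\<^esub> x = \<zero>\<^bsub>total_fractions R\<^esub>" by blast
  qed (auto simp: fraction_zero one_nonzerodivisor)
  show "Group.comm_monoid (total_fractions R)"
  proof (rule comm_monoidI)
    fix x y z
    assume xc: "x \<in> carrier (total_fractions R)" and yc: "y \<in> carrier (total_fractions R)"
      and zc: "z \<in> carrier (total_fractions R)"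
    from xc obtain a s where x: "x = fraction R a s"
      and cx: "a \<in> carrier R" "s \<in> nonzerodivisors R" by (rule total_fractionsE)
    from yc obtain b t where y: "y = fraction R b t"
      and cy: "b \<in> carrier R" "t \<in> nonzerodivisors R" by (rule total_fractionsE)
    from zc obtain c u where z: "z = fraction R c u"
      and cz: "c \<in> carrier R" "u \<in> nonzerodivisors R" by (rule total_fractionsE)
    show "x \<otimes>\<^bsub>total_fractions R\<^esub> y \<otimes>\<^bsub>total_fractions R\<^esub> z =
        x \<otimes>\<^bsub>total_fractions R\<^esub> (y \<otimes>\<^bsub>total_fractions R\<^esub> z)"
      using cx cx(2)[THEN d] cy cy(2)[THEN d] cz cz(2)[THEN d] unfolding x y z by (simp add: simps m_ac)
  next
    fix x y
    assume xc: "x \<in> carrier (total_fractions R)" and yc: "y \<in> carrier (total_fractions R)"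
    from xc obtain a s where x: "x = fraction R a s"
      and cx: "a \<in> carrier R" "s \<in> nonzerodivisors R" by (rule total_fractionsE)
    from yc obtain b t where y: "y = fraction R b t"
      and cy: "b \<in> carrier R" "t \<in> nonzerodivisors R" by (rule total_fractionsE)
    show "x \<otimes>\<^bsub>total_fractions R\<^esub> y \<in> carrier (total_fractions R)"
      using cx cx(2)[THEN d] cy cy(2)[THEN d] unfolding x y by (auto simp: simps intro!: fraction_in_carrier)
    show "x \<otimes>\<^bsub>total_fractions R\<^esub> y = y \<otimes>\<^bsub>total_fractions R\<^esub> x"
      using cx cx(2)[THEN d] cy cy(2)[THEN d] unfolding x y by (simp add: simps m_ac)
  next
    fix x assume xc: "x \<in> carrier (total_fractions R)"
    from xc obtain a s where x: "x = fraction R a s"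
      and cx: "a \<in> carrier R" "s \<in> nonzerodivisors R" by (rule total_fractionsE)
    show "\<one>\<^bsub>total_fractions R\<^esub> \<otimes>\<^bsub>total_fractions R\<^esub> x = x"
      using cx cx(2)[THEN d] unfolding x by (simp add: simps)
  qed (auto simp: fraction_one one_nonzerodivisor)
  fix x y z
  assume xc: "x \<in> carrier (total_fractions R)" and yc: "y \<in> carrier (total_fractions R)"
    and zc: "z \<in> carrier (total_fractions R)"
  from xc obtain a s where x: "x = fraction R a s"
    and cx: "a \<in> carrier R" "s \<in> nonzerodivisors R" by (rule total_fractionsE)
  from yc obtain b t where y: "y = fraction R b t"
    and cy: "b \<in> carrier R" "t \<in> nonzerodivisors R" by (rule total_fractionsE)
  from zc obtain c u where z: "z = fraction R c u"
    and cz: "c \<in> carrier R" "u \<in> nonzerodivisors R" by (rule total_fractionsE)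
  show "(x \<oplus>\<^bsub>total_fractions R\<^esub> y) \<otimes>\<^bsub>total_fractions R\<^esub> z =
      x \<otimes>\<^bsub>total_fractions R\<^esub> z \<oplus>\<^bsub>total_fractions R\<^esub> y \<otimes>\<^bsub>total_fractions R\<^esub> z"
    proof -
    note c = cx cx(2)[THEN d] cy cy(2)[THEN d] cz cz(2)[THEN d]
    have "(a \<otimes> t \<oplus> b \<otimes> s) \<otimes> c \<otimes> (s \<otimes> u \<otimes> (t \<otimes> u)) =
        (a \<otimes> c \<otimes> (t \<otimes> u) \<oplus> b \<otimes> c \<otimes> (s \<otimes> u)) \<otimes> (s \<otimes> t \<otimes> u)"
      using c by (simp add: l_distr r_distr m_ac)
    then show ?thesis
      unfolding x y z using c by (simp add: fraction_add fraction_mult nonzerodivisors_mult fraction_eq_iff)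
  qed
qed

end

lemma (in "domain") nonzerodivisors_domain: "nonzerodivisors R = carrier R - {\<zero>}"
proof (intro equalityI subsetI)
  fix s assume s: "s \<in> nonzerodivisors R"
  have "s \<noteq> \<zero>"
    using nonzerodivisorsD(2)[OF s one_closed] one_not_zero by auto
  then show "s \<in> carrier R - {\<zero>}" using nonzerodivisorsD(1)[OF s] by simp
next
  fix s assume s: "s \<in> carrier R - {\<zero>}"
  then show "s \<in> nonzerodivisors R"
    unfolding nonzerodivisors_def using integral by blast
qed

section \<open>Residue fields and contraction to a subring\<close>

text \<open>
  The element \<open>a / s\<close> of the residue field at \<open>Q\<close>, for ring elements \<open>a\<close> and \<open>s\<close> with \<open>s \<notin> Q\<close>.
  It spares handling cosets of cosets.
\<close>

definition residue :: "('a, 'b) ring_scheme \<Rightarrow> 'a set \<Rightarrow> 'a \<Rightarrow> 'a \<Rightarrow> ('a set \<times> 'a set) set" where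
  "residue R Q a s = fraction (R Quot Q) (Q +>\<^bsub>R\<^esub> a) (Q +>\<^bsub>R\<^esub> s)"

context primeideal
begin

lemma coset_carrier: "a \<in> carrier R \<Longrightarrow> I +> a \<in> carrier (R Quot I)"
  by (simp add: FactRing_def a_rcosetsI[OF a_subset])

lemma coset_carrierE:
  assumes "U \<in> carrier (R Quot I)"
  obtains a where "a \<in> carrier R" "U = I +> a"
  using assms by (auto simp: FactRing_simps)

lemma coset_eq_iff:
  "\<lbrakk>a \<in> carrier R; b \<in> carrier R\<rbrakk> \<Longrightarrow> I +> a = I +> b \<longleftrightarrow> a \<ominus> b \<in> I"
  using quotient_eq_iff_same_a_r_cos[OF is_ideal] by simp

lemma nonzerodivisors_Quot:
  assumes "s \<in> carrier R"
  shows "I +> s \<in> nonzerodivisors (R Quot I) \<longleftrightarrow> s \<notin> I"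
proof -
  have "I +> s = I \<longleftrightarrow> s \<in> I"
    using a_rcos_zero[OF is_ideal] a_rcos_self[OF assms] by auto
  moreover have "\<zero>\<^bsub>R Quot I\<^esub> = I" by (simp add: FactRing_def)
  ultimately show ?thesis
    using coset_carrier[OF assms]
    by (simp add: domain.nonzerodivisors_domain[OF quotient_is_domain])
qed

lemma cring_Quot: "cring (R Quot I)"
  using quotient_is_domain by (rule domain.axioms)

lemma coset_mult:
  "\<lbrakk>a \<in> carrier R; b \<in> carrier R\<rbrakk> \<Longrightarrow> (I +> a) \<otimes>\<^bsub>R Quot I\<^esub> (I +> b) = I +> (a \<otimes> b)"
  by (simp add: FactRing_def rcoset_mult_add)

lemma coset_add:
  "\<lbrakk>a \<in> carrier R; b \<in> carrier R\<rbrakk> \<Longrightarrow> (I +> a) \<oplus>\<^bsub>R Quot I\<^esub> (I +> b) = I +> (a \<oplus> b)"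
  by (simp add: FactRing_def a_rcos_sum)

lemma residue_carrier:
  "\<lbrakk>a \<in> carrier R; s \<in> carrier R; s \<notin> I\<rbrakk> \<Longrightarrow> residue R I a s \<in> carrier (residue_field R I)"
  unfolding residue_def residue_field_def
  by (intro cring.fraction_in_carrier[OF cring_Quot] coset_carrier)
    (simp_all add: nonzerodivisors_Quot)

lemma residueE:
  assumes "x \<in> carrier (residue_field R I)"
  obtains a s where "a \<in> carrier R" "s \<in> carrier R" "s \<notin> I" "x = residue R I a s"
proof -
  obtain U V where U: "U \<in> carrier (R Quot I)" and V: "V \<in> nonzerodivisors (R Quot I)"
    and x: "x = fraction (R Quot I) U V"
    using assms unfolding residue_field_def by (rule cring.total_fractionsE[OF cring_Quot])
  obtain a where a: "a \<in> carrier R" "U = I +> a" using U by (rule coset_carrierE)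
  have "V \<in> carrier (R Quot I)" using V by (simp add: nonzerodivisors_def)
  then obtain s where s: "s \<in> carrier R" "V = I +> s" by (rule coset_carrierE)
  show ?thesis
    using that[of a s] a s V x nonzerodivisors_Quot[of s] by (simp add: residue_def)
qed

lemma residue_eq_iff:
  assumes "a \<in> carrier R" "b \<in> carrier R" "s \<in> carrier R" "t \<in> carrier R" "s \<notin> I" "t \<notin> I"
  shows "residue R I a s = residue R I b t \<longleftrightarrow> a \<otimes> t \<ominus> b \<otimes> s \<in> I"
  unfolding residue_def
  using assms
  by (simp add: cring.fraction_eq_iff[OF cring_Quot] nonzerodivisors_Quot coset_carrier
      coset_mult coset_eq_iff)

lemma not_in_mult:
  "\<lbrakk>s \<in> carrier R; t \<in> carrier R; s \<notin> I; t \<notin> I\<rbrakk> \<Longrightarrow> s \<otimes> t \<notin> I"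
  using I_prime by blast

lemma one_not_in: "\<one> \<notin> I"
  using I_notcarr one_imp_carrier by blast

lemma residue_mult:
  assumes "a \<in> carrier R" "b \<in> carrier R" "s \<in> carrier R" "t \<in> carrier R" "s \<notin> I" "t \<notin> I"
  shows "residue R I a s \<otimes>\<^bsub>residue_field R I\<^esub> residue R I b t = residue R I (a \<otimes> b) (s \<otimes> t)"
  using assms unfolding residue_def residue_field_def
  by (simp add: cring.fraction_mult[OF cring_Quot] nonzerodivisors_Quot coset_carrier coset_mult)

lemma residue_add:
  assumes "a \<in> carrier R" "b \<in> carrier R" "s \<in> carrier R" "t \<in> carrier R" "s \<notin> I" "t \<notin> I"
  shows "residue R I a s \<oplus>\<^bsub>residue_field R I\<^esub> residue R I b t =
    residue R I (a \<otimes> t \<oplus> b \<otimes> s) (s \<otimes> t)"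
  using assms unfolding residue_def residue_field_def
  by (simp add: cring.fraction_add[OF cring_Quot] nonzerodivisors_Quot coset_carrier coset_mult
      coset_add)

lemma residue_one: "\<one>\<^bsub>residue_field R I\<^esub> = residue R I \<one> \<one>"
  unfolding residue_def residue_field_def cring.fraction_one[OF cring_Quot]
  by (simp add: FactRing_def)

lemma cring_residue_field: "cring (residue_field R I)"
  unfolding residue_field_def by (rule cring.cring_total_fractions[OF cring_Quot])

lemma residue_pow:
  assumes "a \<in> carrier R"
  shows "residue R I a \<one> [^]\<^bsub>residue_field R I\<^esub> (n::nat) = residue R I (a [^] n) \<one>"
proof (induction n)
  case 0
  then show ?case by (simp add: residue_one)
next
  case (Suc n)
  then show ?case using assms one_not_in by (simp add: residue_mult)
qed

end

text \<open>
  Subtraction in a subring is defined through an inverse that is sought in the subring only;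
  by uniqueness of inverses it agrees with subtraction in the big ring.
\<close>

lemma (in ring) a_minus_consistent:
  assumes "subring A R" "a \<in> A" "b \<in> A"
  shows "a \<ominus>\<^bsub>R\<lparr>carrier := A\<rparr>\<^esub> b = a \<ominus> b"
proof -
  have "subgroup A (add_monoid R)" using assms(1) by (rule subring.axioms)
  from add.m_inv_consistent[OF this assms(3)] show ?thesis
    by (simp add: a_minus_def a_inv_def)
qed

lemma (in cring) primeideal_contraction:
  assumes "subring A R" "primeideal Q R"
  shows "primeideal (Q \<inter> A) (R\<lparr>carrier := A\<rparr>)"
proof -
  have "cring (R\<lparr>carrier := A\<rparr>)"
    using subcring_iff[OF subringE(1)[OF assms(1)]] subcringI'[OF assms(1)] by simp
  moreover have "id \<in> ring_hom (R\<lparr>carrier := A\<rparr>) R"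
    using subringE(1)[OF assms(1)] by (auto intro!: ring_hom_memI)
  then have "ring_hom_ring (R\<lparr>carrier := A\<rparr>) R id"
    by (intro ring_hom_ringI2 subring_is_ring[OF assms(1)] ring_axioms)
  ultimately have "primeideal {r \<in> carrier (R\<lparr>carrier := A\<rparr>). id r \<in> Q} (R\<lparr>carrier := A\<rparr>)"
    using ring_hom_ring.primeideal_vimage assms(2) by blast
  then show ?thesis by (simp add: Int_def conj_commute)
qed

text \<open>
  This justifies the formula that defines the induced map: adding \<open>Q\<close> to a coset of \<open>Q \<inter> A\<close>
  gives the coset of \<open>Q\<close> with the same representative, and the resulting fraction does not
  depend on the representatives.
\<close>

lemma (in cring) residue_map_residue:
  assumes A: "subring A R" and Q: "primeideal Q R"
    and a: "a \<in> A" and s: "s \<in> A" "s \<notin> Q"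
  shows "residue_map R Q (residue (R\<lparr>carrier := A\<rparr>) (Q \<inter> A) a s) = residue R Q a s"
proof -
  let ?E = "R\<lparr>carrier := A\<rparr>" and ?P = "Q \<inter> A"
  interpret Q: primeideal Q R by fact
  interpret P: primeideal ?P ?E by (rule primeideal_contraction[OF A Q])
  note AR = subsetD[OF subringE(1)[OF A]]
  have sum: "Q <+>\<^bsub>R\<^esub> (?P +>\<^bsub>?E\<^esub> b) = Q +> b" if b: "b \<in> A" for b
  proof -
    have "\<exists>z \<in> Q. x \<oplus> (p \<oplus> b) = z \<oplus> b" if "x \<in> Q" "p \<in> Q" for x p
      using that AR[OF b] by (intro bexI[of _ "x \<oplus> p"]) (auto simp: a_assoc Q.Icarr)
    moreover have "\<exists>z \<in> Q. \<exists>p \<in> ?P. x \<oplus> b = z \<oplus> (p \<oplus> b)" if "x \<in> Q" for x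
      using that AR[OF b] additive_subgroup.zero_closed[OF Q.is_additive_subgroup] subringE(2)[OF A] by (intro bexI[of _ x] bexI[of _ "\<zero>"]) auto
    ultimately show ?thesis
      unfolding set_add_def set_mult_def a_r_coset_def r_coset_def by fastforce
  qed
  show ?thesis
    unfolding residue_map_def residue_def[of ?E]
  proof (rule cring.UN_fraction[OF P.cring_Quot])
    show "?P +>\<^bsub>?E\<^esub> a \<in> carrier (?E Quot ?P)" using a P.coset_carrier by simp
    show "?P +>\<^bsub>?E\<^esub> s \<in> nonzerodivisors (?E Quot ?P)" using s P.nonzerodivisors_Quot by simp
    fix U V
    assume U: "U \<in> carrier (?E Quot ?P)" and V: "V \<in> nonzerodivisors (?E Quot ?P)"
      and eq: "(?P +>\<^bsub>?E\<^esub> a) \<otimes>\<^bsub>?E Quot ?P\<^esub> V = U \<otimes>\<^bsub>?E Quot ?P\<^esub> (?P +>\<^bsub>?E\<^esub> s)"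
    obtain b where b: "b \<in> A" "U = ?P +>\<^bsub>?E\<^esub> b" using U by (auto elim: P.coset_carrierE)
    have "V \<in> carrier (?E Quot ?P)" using V by (simp add: nonzerodivisors_def)
    then obtain t where t: "t \<in> A" "V = ?P +>\<^bsub>?E\<^esub> t" by (auto elim: P.coset_carrierE)
    have tQ: "t \<notin> Q" using V t P.nonzerodivisors_Quot[of t] by simp
    have "?P +>\<^bsub>?E\<^esub> (a \<otimes> t) = ?P +>\<^bsub>?E\<^esub> (b \<otimes> s)"
      using eq P.coset_mult[of a t] P.coset_mult[of b s] a s t b by simp
    then have "a \<otimes> t \<ominus>\<^bsub>?E\<^esub> b \<otimes> s \<in> ?P"
      using P.coset_eq_iff[of "a \<otimes> t" "b \<otimes> s"] subringE(6)[OF A] a s t b by simp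
    then have d: "a \<otimes> t \<ominus> b \<otimes> s \<in> Q"
      using a_minus_consistent[OF A] subringE(6)[OF A] a s t b by simp
    then have "b \<otimes> s \<ominus> a \<otimes> t \<in> Q"
      using additive_subgroup.a_inv_closed[OF Q.is_additive_subgroup d] a b s t AR by (simp add: minus_add a_minus_def a_comm)
    then have "residue R Q b t = residue R Q a s"
      using Q.residue_eq_iff a b s t AR tQ by simp
    then show "fraction (R Quot Q) (Q <+>\<^bsub>R\<^esub> U) (Q <+>\<^bsub>R\<^esub> V) = residue R Q a s"
      unfolding b t sum[OF b(1)] sum[OF t(1)] residue_def .
  qed
qed

text \<open>
  The map on residue fields is automatically an injective homomorphism, so only surjectivity
  needs an argument; it means that every fraction over the larger ring can be rewritten with
  numerator and denominator in the subring.
\<close>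

lemma (in cring) residue_map_iso:
  assumes A: "subring A R" and Q: "primeideal Q R"
    and surj: "\<And>c s. \<lbrakk>c \<in> carrier R; s \<in> carrier R; s \<notin> Q\<rbrakk> \<Longrightarrow>
      \<exists>a \<in> A. \<exists>t \<in> A. t \<notin> Q \<and> a \<otimes> s \<ominus> c \<otimes> t \<in> Q"
  shows "residue_map R Q \<in> ring_iso (residue_field (R\<lparr>carrier := A\<rparr>) (Q \<inter> A)) (residue_field R Q)"
proof -
  let ?E = "R\<lparr>carrier := A\<rparr>" and ?P = "Q \<inter> A"
  interpret Q: primeideal Q R by fact
  interpret P: primeideal ?P ?E by (rule primeideal_contraction[OF A Q])
  note AR = subsetD[OF subringE(1)[OF A]] and cl = subringE(6,7)[OF A]
  note map = residue_map_residue[OF A Q]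
  have elt: "\<exists>a s. a \<in> A \<and> s \<in> A \<and> s \<notin> Q \<and> x = residue ?E ?P a s"
    if x: "x \<in> carrier (residue_field ?E ?P)" for x
    using x by (rule P.residueE) auto
  show ?thesis
  proof (rule ring_iso_memI)
    fix x assume "x \<in> carrier (residue_field ?E ?P)"
    then obtain a s where "a \<in> A" "s \<in> A" "s \<notin> Q" "x = residue ?E ?P a s" using elt by blast
    then show "residue_map R Q x \<in> carrier (residue_field R Q)"
      by (simp add: map Q.residue_carrier AR)
  next
    fix x y
    assume xy: "x \<in> carrier (residue_field ?E ?P)" "y \<in> carrier (residue_field ?E ?P)"
    obtain a s where x: "a \<in> A" "s \<in> A" "s \<notin> Q" "x = residue ?E ?P a s"
      using elt[OF xy(1)] by blast
    obtain b t where y: "b \<in> A" "t \<in> A" "t \<notin> Q" "y = residue ?E ?P b t"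
      using elt[OF xy(2)] by blast
    have st: "s \<otimes> t \<notin> Q" using Q.not_in_mult x y AR by blast
    show "residue_map R Q (x \<otimes>\<^bsub>residue_field ?E ?P\<^esub> y) =
        residue_map R Q x \<otimes>\<^bsub>residue_field R Q\<^esub> residue_map R Q y"
      using x(1-3) y(1-3) st P.residue_mult[of a b s t]
      by (simp add: x(4) y(4) map Q.residue_mult AR cl)
    show "residue_map R Q (x \<oplus>\<^bsub>residue_field ?E ?P\<^esub> y) =
        residue_map R Q x \<oplus>\<^bsub>residue_field R Q\<^esub> residue_map R Q y"
      using x(1-3) y(1-3) st P.residue_add[of a b s t]
      by (simp add: x(4) y(4) map Q.residue_add AR cl)
  next
    show "residue_map R Q \<one>\<^bsub>residue_field ?E ?P\<^esub> = \<one>\<^bsub>residue_field R Q\<^esub>"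
      unfolding P.residue_one Q.residue_one
      using map[of \<one> \<one>] Q.one_not_in subringE(3)[OF A] by simp
  next
    have "inj_on (residue_map R Q) (carrier (residue_field ?E ?P))"
    proof (rule inj_onI)
      fix x y
      assume xy: "x \<in> carrier (residue_field ?E ?P)" "y \<in> carrier (residue_field ?E ?P)"
        and eq: "residue_map R Q x = residue_map R Q y"
      obtain a s where x: "a \<in> A" "s \<in> A" "s \<notin> Q" "x = residue ?E ?P a s"
        using elt[OF xy(1)] by blast
      obtain b t where y: "b \<in> A" "t \<in> A" "t \<notin> Q" "y = residue ?E ?P b t"
        using elt[OF xy(2)] by blast
      have "residue R Q a s = residue R Q b t"
        using eq x y by (simp add: map)
      then have "a \<otimes> t \<ominus> b \<otimes> s \<in> Q"
        using Q.residue_eq_iff[of a b s t] x(1-3) y(1-3) AR by simp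
      moreover have "a \<otimes> t \<ominus>\<^bsub>?E\<^esub> b \<otimes> s = a \<otimes> t \<ominus> b \<otimes> s"
        using a_minus_consistent[OF A] cl x y by simp
      moreover have "a \<otimes> t \<ominus>\<^bsub>?E\<^esub> b \<otimes> s \<in> A"
        using P.minus_closed[of "a \<otimes> t" "b \<otimes> s"] cl x y by simp
      ultimately show "x = y"
        using P.residue_eq_iff[of a b s t] x y by simp
    qed
    moreover have "carrier (residue_field R Q) \<subseteq> residue_map R Q ` carrier (residue_field ?E ?P)"
    proof
      fix y assume "y \<in> carrier (residue_field R Q)"
      then obtain c s where c: "c \<in> carrier R" "s \<in> carrier R" "s \<notin> Q" and y: "y = residue R Q c s"
        by (rule Q.residueE)
      obtain a t where a: "a \<in> A" "t \<in> A" "t \<notin> Q" "a \<otimes> s \<ominus> c \<otimes> t \<in> Q" using surj[OF c] by blast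
      have "y = residue R Q a t"
        using Q.residue_eq_iff[of a c t s] a c AR by (simp add: y)
      then have "y = residue_map R Q (residue ?E ?P a t)" using a by (simp add: map)
      moreover have "residue ?E ?P a t \<in> carrier (residue_field ?E ?P)"
        using P.residue_carrier[of a t] a by simp
      ultimately show "y \<in> residue_map R Q ` carrier (residue_field ?E ?P)" by blast
    qed
    moreover have "residue_map R Q ` carrier (residue_field ?E ?P) \<subseteq> carrier (residue_field R Q)"
    proof
      fix y assume "y \<in> residue_map R Q ` carrier (residue_field ?E ?P)"
      then obtain x where "x \<in> carrier (residue_field ?E ?P)" "y = residue_map R Q x" by blast
      then obtain a s where "a \<in> A" "s \<in> A" "s \<notin> Q" "y = residue_map R Q (residue ?E ?P a s)"
        using elt by blast
      then show "y \<in> carrier (residue_field R Q)"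
        by (simp add: map Q.residue_carrier AR)
    qed
    ultimately show "bij_betw (residue_map R Q) (carrier (residue_field ?E ?P))
        (carrier (residue_field R Q))"
      by (auto simp: bij_betw_def)
  qed
qed

lemma ring_iso_imp_purely_inseparable:
  assumes "cring L" "\<phi> \<in> ring_iso K L"
  shows "purely_inseparable K L \<phi>"
proof -
  interpret L: cring L by fact
  have "x \<in> \<phi> ` carrier K" if "x \<in> carrier L" for x
    using that ring_iso_memE(5)[OF assms(2)] by (auto simp: bij_betw_def)
  then have "\<forall>x \<in> carrier L. x [^]\<^bsub>L\<^esub> (char_exponent K ^ 0) \<in> \<phi> ` carrier K"
    by simp
  then show ?thesis
    using assms(2) unfolding purely_inseparable_def ring_iso_def by blast
qed

section \<open>Adjoining the radical of a conductor ideal\<close>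

text \<open>
  In a commutative ring, negation is multiplication by \<open>-1\<close>, so an ideal need not be checked for
  additive inverses.
\<close>

lemma (in cring) idealI':
  assumes "J \<subseteq> carrier R" "\<zero> \<in> J"
    and add: "\<And>x y. \<lbrakk>x \<in> J; y \<in> J\<rbrakk> \<Longrightarrow> x \<oplus> y \<in> J"
    and mult: "\<And>r x. \<lbrakk>r \<in> carrier R; x \<in> J\<rbrakk> \<Longrightarrow> r \<otimes> x \<in> J"
  shows "ideal J R"
proof (rule idealI[OF ring_axioms])
  have "\<ominus> x \<in> J" if "x \<in> J" for x
  proof -
    have "\<ominus> x = (\<ominus> \<one>) \<otimes> x" using that assms(1) l_minus[of \<one> x] by auto
    then show ?thesis using that by (simp add: mult)
  qed
  then show "subgroup J (add_monoid R)"
    using assms(1,2) add by (intro add.subgroupI) (auto simp: a_inv_def)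
  fix a x assume "a \<in> J" "x \<in> carrier R"
  then show "x \<otimes> a \<in> J" "a \<otimes> x \<in> J"
    using mult[of x a] m_comm[of a x] assms(1) by auto
qed

lemma (in ideal) idealE:
  shows "\<zero> \<in> I"
    and "\<And>x y. \<lbrakk>x \<in> I; y \<in> I\<rbrakk> \<Longrightarrow> x \<oplus> y \<in> I"
    and "\<And>x y. \<lbrakk>x \<in> I; y \<in> I\<rbrakk> \<Longrightarrow> x \<ominus> y \<in> I"
    and "\<And>x. x \<in> I \<Longrightarrow> x \<in> carrier R"
    and "\<And>r x. \<lbrakk>r \<in> carrier R; x \<in> I\<rbrakk> \<Longrightarrow> r \<otimes> x \<in> I"
    and "\<And>r x. \<lbrakk>r \<in> carrier R; x \<in> I\<rbrakk> \<Longrightarrow> x \<otimes> r \<in> I"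
  using additive_subgroup.zero_closed[OF is_additive_subgroup]
    additive_subgroup.a_closed[OF is_additive_subgroup]
    additive_subgroup.a_inv_closed[OF is_additive_subgroup]
  by (auto simp: a_minus_def Icarr I_l_closed I_r_closed)

lemma (in primeideal) pow_in_imp_in:
  assumes "x \<in> carrier R" "x [^] (n::nat) \<in> I"
  shows "x \<in> I"
  using assms(2)
proof (induction n)
  case 0
  then show ?case using one_not_in by simp
next
  case (Suc n)
  then show ?case using I_prime[of "x [^] n" x] assms(1) by auto
qed

lemma (in cring) ideal_ideal_radical:
  assumes "ideal J R"
  shows "ideal (ideal_radical R J) R"
proof (rule idealI')
  interpret J: ideal J R by fact
  show "ideal_radical R J \<subseteq> carrier R" by (auto simp: ideal_radical_def)
  show "\<zero> \<in> ideal_radical R J"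
    using J.idealE(1) by (auto simp: ideal_radical_def intro!: exI[of _ "1::nat"])
  fix r x assume r: "r \<in> carrier R" and "x \<in> ideal_radical R J"
  then obtain n :: nat where x: "x \<in> carrier R" "n > 0" "x [^] n \<in> J" by (auto simp: ideal_radical_def)
  have "(r \<otimes> x) [^] n \<in> J" using r x by (simp add: nat_pow_distrib J.I_l_closed)
  then show "r \<otimes> x \<in> ideal_radical R J" using r x by (auto simp: ideal_radical_def)
next
  interpret J: ideal J R by fact
  fix x y assume "x \<in> ideal_radical R J" "y \<in> ideal_radical R J"
  then obtain m n :: nat where x: "x \<in> carrier R" "m > 0" "x [^] m \<in> J"
    and y: "y \<in> carrier R" "n > 0" "y [^] n \<in> J" by (auto simp: ideal_radical_def)
  (* Expanding one factor x + y at a time avoids the binomial theorem. *)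
  have "x [^] i \<otimes> y [^] j \<otimes> (x \<oplus> y) [^] k \<in> J" if "m + n \<le> i + j + k" for i j k :: nat
    using that
  proof (induction k arbitrary: i j)
    case 0
    then consider "m \<le> i" | "n \<le> j" by linarith
    then show ?case
    proof cases
      case 1
      then have "x [^] i = x [^] (i - m) \<otimes> x [^] m" using x by (simp add: nat_pow_mult)
      then show ?thesis using x y by (simp add: J.I_l_closed J.I_r_closed)
    next
      case 2
      then have "y [^] j = y [^] (j - n) \<otimes> y [^] n" using y by (simp add: nat_pow_mult)
      then show ?thesis using x y by (simp add: J.I_l_closed)
    qed
  next
    case (Suc k)
    have "x [^] i \<otimes> y [^] j \<otimes> (x \<oplus> y) [^] Suc k =
        x [^] Suc i \<otimes> y [^] j \<otimes> (x \<oplus> y) [^] k \<oplus> x [^] i \<otimes> y [^] Suc j \<otimes> (x \<oplus> y) [^] k"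
      using x y by (simp add: l_distr r_distr m_ac)
    then show ?case using Suc.IH[of "Suc i" j] Suc.IH[of i "Suc j"] Suc.prems J.idealE(2) by simp
  qed
  from this[of 0 0 "m + n"] have "(x \<oplus> y) [^] (m + n) \<in> J" using x y by simp
  then show "x \<oplus> y \<in> ideal_radical R J"
    using x y by (auto simp: ideal_radical_def intro!: exI[of _ "m + n"])
qed

lemma (in primeideal) radical_subset_prime:
  "J \<subseteq> I \<Longrightarrow> ideal_radical R J \<subseteq> I"
  using pow_in_imp_in by (auto simp: ideal_radical_def)

text \<open>
  Here \<open>J\<close> is an ideal of the big ring that happens to lie in the subring \<open>A\<close>, and the big ring is
  obtained from \<open>A\<close> by adding elements that are nilpotent modulo \<open>J\<close>. Such an extension does not
  change the spectrum or the residue fields.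
\<close>

locale conductor_extension = cring R for R (structure) +
  fixes A J
  assumes A: "subring A R" and J: "ideal J R" and JA: "J \<subseteq> A"
    and decomp: "\<And>c. c \<in> carrier R \<Longrightarrow> \<exists>a \<in> A. \<exists>w \<in> ideal_radical R J. c = a \<oplus> w"
begin

abbreviation "E \<equiv> R\<lparr>carrier := A\<rparr>"
abbreviation "N \<equiv> ideal_radical R J"

lemmas AR = subsetD[OF subringE(1)[OF A]] and Acl = subringE[OF A]

lemma N: "ideal N R" by (rule ideal_ideal_radical[OF J])

text \<open>
  Away from \<open>J\<close> an element \<open>f\<close> of \<open>J\<close> outside a prime multiplies the whole ring into \<open>A\<close>, so
  the two rings agree there; over \<open>J\<close> a prime contains the radical of \<open>J\<close>, modulo which
  the two rings agree.
\<close>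

lemma prime_determined:
  assumes Q: "primeideal Q R" and Q': "primeideal Q' R" and eq: "Q \<inter> A \<subseteq> Q' \<inter> A"
    and eq': "J \<subseteq> Q' \<Longrightarrow> J \<subseteq> Q"
  shows "Q \<subseteq> Q'"
proof
  interpret Q: primeideal Q R by fact
  interpret Q': primeideal Q' R by fact
  interpret J: ideal J R by (rule J)
  fix c assume c: "c \<in> Q"
  then have cR: "c \<in> carrier R" by (rule Q.Icarr)
  show "c \<in> Q'"
  proof (cases "J \<subseteq> Q'")
    case True
    obtain a w where a: "a \<in> A" "w \<in> N" "c = a \<oplus> w" using decomp[OF cR] by blast
    have w: "w \<in> Q" "w \<in> Q'"
      using a True eq' Q.radical_subset_prime Q'.radical_subset_prime by blast+
    have "a = c \<ominus> w" using a AR Q.Icarr[OF w(1)] by algebra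
    then have "a \<in> Q'" using Q.idealE(3)[OF c w(1)] a eq by blast
    then show ?thesis using w a Q'.idealE(2) by blast
  next
    case False
    then obtain f where f: "f \<in> J" "f \<notin> Q'" by blast
    have fR: "f \<in> carrier R" using f J.Icarr by blast
    have "f \<otimes> c \<in> A" using f cR J.I_r_closed JA by blast
    then have "f \<otimes> c \<in> Q'" using Q.I_l_closed[OF c fR] eq by blast
    then show ?thesis using Q'.I_prime[OF fR cR] f by blast
  qed
qed

text \<open>
  The lift is \<open>P + N\<close> if \<open>J \<subseteq> P\<close>: an element of \<open>A \<inter> N\<close> has a power in \<open>J \<subseteq> P\<close>, so
  \<open>(P + N) \<inter> A = P\<close>. Otherwise it is \<open>{c. f c \<in> P}\<close> for any \<open>f \<in> J - P\<close>, which makes sense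
  because \<open>f\<close> carries the big ring into \<open>A\<close>.
\<close>

lemma prime_lift:
  assumes P: "primeideal P E"
  shows "\<exists>Q. primeideal Q R \<and> Q \<inter> A = P"
proof -
  interpret P: primeideal P E by fact
  interpret J: ideal J R by (rule J)
  interpret N: ideal N R by (rule N)
  have PA: "p \<in> A" if "p \<in> P" for p using P.Icarr[OF that] by simp
  have Padd: "p \<oplus> q \<in> P" if "p \<in> P" "q \<in> P" for p q using P.idealE(2)[OF that] by simp
  have Pmult: "a \<otimes> p \<in> P" if "a \<in> A" "p \<in> P" for a p using P.idealE(5)[of a p] that by simp
  have Pprime: "a \<in> P \<or> b \<in> P" if "a \<in> A" "b \<in> A" "a \<otimes> b \<in> P" for a b
    using P.I_prime[of a b] that by simp
  have PR: "p \<in> carrier R" if "p \<in> P" for p using AR PA that by blast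
  show ?thesis
  proof (cases "J \<subseteq> P")
    case True
    have NA: "w \<in> P" if w: "w \<in> N" "w \<in> A" for w
    proof -
      obtain n :: nat where "w [^] n \<in> J" using w(1) unfolding ideal_radical_def by blast
      then have "w [^] n \<in> P" using True by blast
      then have "w [^]\<^bsub>E\<^esub> n \<in> P" unfolding nat_pow_consistent[of w n A] .
      then show ?thesis using P.pow_in_imp_in[of w n] w(2) by simp
    qed
    let ?Q = "{p \<oplus> w | p w. p \<in> P \<and> w \<in> N}"
    have PQ: "p \<in> ?Q" if "p \<in> P" for p
    proof -
      have "p = p \<oplus> \<zero>" using PR[OF that] by simp
      then show ?thesis using that N.idealE(1) by blast
    qed
    have NQ: "w \<in> ?Q" if "w \<in> N" for w
    proof -
      have "w = \<zero> \<oplus> w" using N.Icarr[OF that] by simp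
      moreover have "\<zero> \<in> P" using P.idealE(1) by simp
      ultimately show ?thesis using that by blast
    qed
    have QA: "x \<in> P" if x: "x \<in> ?Q" "x \<in> A" for x
    proof -
      obtain p w where p: "p \<in> P" "w \<in> N" "x = p \<oplus> w" using x by blast
      have "w = x \<oplus> \<ominus> p" using p PR N.Icarr by algebra
      also have "\<dots> \<in> A" by (rule Acl(7)[OF x(2) Acl(5)[OF PA[OF p(1)]]])
      finally have "w \<in> A" .
      then show ?thesis using p NA Padd by blast
    qed
    have "primeideal ?Q R"
    proof (rule primeidealI)
      show id: "ideal ?Q R"
      proof (rule idealI')
        show "?Q \<subseteq> carrier R" using PR N.Icarr by blast
        show "\<zero> \<in> ?Q" using NQ N.idealE(1) by blast
      next
        fix x y assume "x \<in> ?Q" "y \<in> ?Q"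
        then obtain p w q v where p: "p \<in> P" "w \<in> N" "x = p \<oplus> w" and q: "q \<in> P" "v \<in> N" "y = q \<oplus> v"
          by blast
        have "x \<oplus> y = (p \<oplus> q) \<oplus> (w \<oplus> v)"
          unfolding p(3) q(3) using p(1,2) q(1,2) PR N.Icarr by (simp add: a_ac)
        then show "x \<oplus> y \<in> ?Q" using p q Padd N.idealE(2) by blast
      next
        fix r x assume r: "r \<in> carrier R" and "x \<in> ?Q"
        then obtain p w where p: "p \<in> P" "w \<in> N" "x = p \<oplus> w" by blast
        obtain a v where a: "a \<in> A" "v \<in> N" "r = a \<oplus> v" using decomp[OF r] by blast
        have "r \<otimes> x = a \<otimes> p \<oplus> (v \<otimes> p \<oplus> r \<otimes> w)"
          unfolding a(3) p(3) using p(1,2) a(1,2) PR AR N.Icarr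
          by (simp add: l_distr r_distr a_ac)
        moreover have "v \<otimes> p \<oplus> r \<otimes> w \<in> N" using N.idealE r p a PR by simp
        ultimately show "r \<otimes> x \<in> ?Q" using Pmult a p by blast
      qed
      show "cring R" by (rule cring_axioms)
      show "carrier R \<noteq> ?Q"
      proof
        assume "carrier R = ?Q"
        then have "\<one> \<in> P" using QA[of \<one>] Acl(3) one_closed by blast
        then show False using P.one_not_in by simp
      qed
      interpret Q: ideal ?Q R by (rule id)
      fix x y assume xy: "x \<in> carrier R" "y \<in> carrier R" "x \<otimes> y \<in> ?Q"
      obtain a w where a: "a \<in> A" "w \<in> N" "x = a \<oplus> w" using decomp[OF xy(1)] by blast
      obtain b v where b: "b \<in> A" "v \<in> N" "y = b \<oplus> v" using decomp[OF xy(2)] by blast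
      have "a \<otimes> b = x \<otimes> y \<ominus> (a \<otimes> v \<oplus> y \<otimes> w)"
        unfolding a(3) b(3) using a(1,2) b(1,2) AR N.Icarr by algebra
      moreover have "a \<otimes> v \<oplus> y \<otimes> w \<in> ?Q"
        by (rule NQ[OF N.idealE(2)[OF N.idealE(5)[OF AR[OF a(1)] b(2)] N.idealE(5)[OF xy(2) a(2)]]])
      ultimately have "a \<otimes> b \<in> ?Q" using xy(3) Q.idealE(3) by simp
      then have "a \<otimes> b \<in> P" by (rule QA[OF _ Acl(6)[OF a(1) b(1)]])
      then have "a \<in> P \<or> b \<in> P" by (rule Pprime[OF a(1) b(1)])
      then show "x \<in> ?Q \<or> y \<in> ?Q" using a b by blast
    qed
    moreover have "?Q \<inter> A = P" using QA PQ PA by blast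
    ultimately show ?thesis by blast
  next
    case False
    then obtain f where f: "f \<in> J" "f \<notin> P" by blast
    have fR: "f \<in> carrier R" using f J.Icarr by blast
    have fc: "f \<otimes> c \<in> A" if "c \<in> carrier R" for c using f that J.I_r_closed JA by blast
    let ?Q = "{c \<in> carrier R. f \<otimes> c \<in> P}"
    have fA: "f \<in> A" using f JA by blast
    have "?Q \<inter> A = P"
      using Pprime[OF fA] f PR PA Pmult[OF fA] by blast
    moreover have "primeideal ?Q R"
    proof (rule primeidealI)
      show "ideal ?Q R"
      proof (rule idealI')
        show "\<zero> \<in> ?Q" using fR P.idealE(1) by simp
      next
        fix x y assume "x \<in> ?Q" "y \<in> ?Q"
        then show "x \<oplus> y \<in> ?Q" using fR Padd by (auto simp: r_distr)
      next
        fix r x assume r: "r \<in> carrier R" and x: "x \<in> ?Q"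
        have "f \<otimes> (f \<otimes> (r \<otimes> x)) = (f \<otimes> r) \<otimes> (f \<otimes> x)" using fR r x by (simp add: m_ac)
        then have "f \<otimes> (f \<otimes> (r \<otimes> x)) \<in> P" using Pmult[OF fc[OF r], of "f \<otimes> x"] x by simp
        then have "f \<otimes> (r \<otimes> x) \<in> P" using Pprime[OF fA fc] f r x by blast
        then show "r \<otimes> x \<in> ?Q" using r x by simp
      qed auto
      show "cring R" by (rule cring_axioms)
      have "\<one> \<notin> ?Q" using f fR by simp
      then show "carrier R \<noteq> ?Q" using one_closed by blast
      fix x y assume xy: "x \<in> carrier R" "y \<in> carrier R" "x \<otimes> y \<in> ?Q"
      have "(f \<otimes> x) \<otimes> (f \<otimes> y) = f \<otimes> (f \<otimes> (x \<otimes> y))" using fR xy(1,2) by (simp add: m_ac)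
      then have "(f \<otimes> x) \<otimes> (f \<otimes> y) \<in> P" using Pmult[OF fA] xy by simp
      then show "x \<in> ?Q \<or> y \<in> ?Q" using Pprime[OF fc fc] xy by blast
    qed
    ultimately show ?thesis by blast
  qed
qed

lemma Spec_bij: "bij_betw (\<lambda>Q. Q \<inter> A) (Spec R) (Spec E)"
proof -
  have "Q = Q'" if "primeideal Q R" "primeideal Q' R" "Q \<inter> A = Q' \<inter> A" for Q Q'
    using prime_determined[OF that(1,2)] prime_determined[OF that(2,1)] that(3) JA by blast
  then show ?thesis
    using primeideal_contraction[OF A] prime_lift
    by (fastforce simp: bij_betw_def inj_on_def Spec_def)
qed

text \<open>
  A fraction \<open>c / s\<close> is rewritten over \<open>A\<close> by dropping the nilpotent parts of \<open>c\<close> and \<open>s\<close> if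
  \<open>J \<subseteq> Q\<close>, and by expanding it with an element of \<open>J\<close> outside \<open>Q\<close> otherwise.
\<close>

lemma residue_iso:
  assumes Q: "primeideal Q R"
  shows "residue_map R Q \<in> ring_iso (residue_field E (Q \<inter> A)) (residue_field R Q)"
proof (rule residue_map_iso[OF A Q])
  interpret Q: primeideal Q R by fact
  interpret J: ideal J R by (rule J)
  fix c s assume cs: "c \<in> carrier R" "s \<in> carrier R" "s \<notin> Q"
  show "\<exists>a \<in> A. \<exists>t \<in> A. t \<notin> Q \<and> a \<otimes> s \<ominus> c \<otimes> t \<in> Q"
  proof (cases "J \<subseteq> Q")
    case True
    then have NQ: "N \<subseteq> Q" by (rule Q.radical_subset_prime)
    obtain a w where a: "a \<in> A" "w \<in> Q" "c = a \<oplus> w" using decomp[OF cs(1)] NQ by blast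
    obtain t v where t: "t \<in> A" "v \<in> Q" "s = t \<oplus> v" using decomp[OF cs(2)] NQ by blast
    have "a \<otimes> s \<ominus> c \<otimes> t = a \<otimes> v \<ominus> t \<otimes> w"
      unfolding a(3) t(3) using a(1,2) t(1,2) AR Q.Icarr by algebra
    moreover have "a \<otimes> v \<ominus> t \<otimes> w \<in> Q" using Q.idealE(3,5) a t AR by simp
    moreover have "t \<notin> Q" using t cs Q.idealE(2) by blast
    ultimately show ?thesis using a(1) t(1) by metis
  next
    case False
    then obtain f where f: "f \<in> J" "f \<notin> Q" by blast
    have fR: "f \<in> carrier R" using f J.Icarr by blast
    have fc: "f \<otimes> x \<in> A" if "x \<in> carrier R" for x using f that J.I_r_closed JA by blast
    have "f \<otimes> s \<notin> Q" using Q.not_in_mult f fR cs by blast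
    moreover have "(f \<otimes> c) \<otimes> s \<ominus> c \<otimes> (f \<otimes> s) = \<zero>" using fR cs by algebra
    ultimately show ?thesis using fc cs Q.idealE(1) by metis
  qed
qed

end

section \<open>Weakly subintegral extensions inside a ring with an involution\<close>

text \<open>
  An ideal that is maximal among those which contain \<open>J\<close> and avoid the powers of \<open>u\<close> is prime:
  if \<open>a\<close> and \<open>b\<close> lie outside it, then adjoining either of them captures a power of \<open>u\<close>, and
  multiplying the two powers shows that \<open>a b\<close> lies outside as well.
\<close>

lemma (in cring) exists_prime_avoiding_powers:
  assumes J: "ideal J R" and u: "u \<in> carrier R" and nil: "\<And>n::nat. u [^] n \<notin> J"
  shows "\<exists>H. primeideal H R \<and> J \<subseteq> H \<and> u \<notin> H"
proof -
  define S where "S = {K. ideal K R \<and> J \<subseteq> K \<and> (\<forall>n::nat. u [^] n \<notin> K)}"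
  have "\<exists>M \<in> S. \<forall>K \<in> S. M \<subseteq> K \<longrightarrow> K = M"
  proof (rule subset_Zorn_nonempty)
    show "S \<noteq> {}" using J nil by (auto simp: S_def)
    fix C assume C: "C \<noteq> {}" "subset.chain S C"
    then have "subset.chain {I. ideal I R} C" by (auto simp: pred_on.chain_def S_def)
    then have "ideal (\<Union>C) R" using chain_Union_is_ideal[of C] C(1) by simp
    moreover have CS: "K \<in> S" if "K \<in> C" for K
      using C(2) that by (auto simp: pred_on.chain_def)
    have "J \<subseteq> \<Union>C" using C(1) CS by (auto simp: S_def)
    moreover have "\<forall>n::nat. u [^] n \<notin> \<Union>C" using CS by (auto simp: S_def)
    ultimately show "\<Union>C \<in> S" by (simp add: S_def)
  qed
  then obtain M where M: "ideal M R" "J \<subseteq> M" "\<And>n::nat. u [^] n \<notin> M"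
    and max: "\<And>K. \<lbrakk>K \<in> S; M \<subseteq> K\<rbrakk> \<Longrightarrow> K = M" by (auto simp: S_def)
  interpret M: ideal M R by fact
  have pow: "\<exists>n::nat. \<exists>x \<in> M. \<exists>r \<in> carrier R. u [^] n = x \<oplus> r \<otimes> a"
    if a: "a \<in> carrier R" "a \<notin> M" for a
  proof -
    let ?K = "{x \<oplus> r \<otimes> a | x r. x \<in> M \<and> r \<in> carrier R}"
    have MK: "M \<subseteq> ?K"
    proof
      fix x assume x: "x \<in> M"
      then have "x = x \<oplus> \<zero> \<otimes> a" using M.Icarr a by simp
      then show "x \<in> ?K" using x by blast
    qed
    have "a = \<zero> \<oplus> \<one> \<otimes> a" using a by simp
    then have "a \<in> ?K" using M.idealE(1) by blast
    have id: "ideal ?K R"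
    proof (rule idealI')
      show "?K \<subseteq> carrier R" using M.Icarr a by auto
      show "\<zero> \<in> ?K" using MK M.idealE(1) by blast
    next
      fix p q assume "p \<in> ?K" "q \<in> ?K"
      then obtain x r y s where p: "x \<in> M" "r \<in> carrier R" "p = x \<oplus> r \<otimes> a"
        and q: "y \<in> M" "s \<in> carrier R" "q = y \<oplus> s \<otimes> a" by blast
      have "p \<oplus> q = (x \<oplus> y) \<oplus> (r \<oplus> s) \<otimes> a"
        unfolding p(3) q(3) using p(1,2) q(1,2) M.Icarr a by (simp add: l_distr a_ac)
      then show "p \<oplus> q \<in> ?K" using M.idealE(2)[OF p(1) q(1)] p(2) q(2) by blast
    next
      fix t p assume t: "t \<in> carrier R" and "p \<in> ?K"
      then obtain x r where p: "x \<in> M" "r \<in> carrier R" "p = x \<oplus> r \<otimes> a" by blast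
      have "t \<otimes> p = t \<otimes> x \<oplus> (t \<otimes> r) \<otimes> a"
        unfolding p(3) using t p(1,2) M.Icarr a by (simp add: r_distr m_ac)
      then show "t \<otimes> p \<in> ?K" using M.idealE(5)[OF t p(1)] t p(2) by blast
    qed
    have ne: "?K \<noteq> M" using \<open>a \<in> ?K\<close> a by blast
    have "J \<subseteq> ?K" using MK M(2) by (rule subset_trans[rotated])
    then have "?K \<in> S" if "\<forall>n::nat. u [^] n \<notin> ?K"
      unfolding S_def using id that by (intro CollectI conjI)
    then have "\<exists>n::nat. u [^] n \<in> ?K" using max[OF _ MK] ne by blast
    then show ?thesis by blast
  qed
  have "primeideal M R"
  proof (rule primeidealI[OF M(1) cring_axioms])
    have "\<one> \<notin> M" using M(3)[of 0] by simp
    then show "carrier R \<noteq> M" by blast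
    fix a b assume ab: "a \<in> carrier R" "b \<in> carrier R" "a \<otimes> b \<in> M"
    show "a \<in> M \<or> b \<in> M"
    proof (rule ccontr)
      assume "\<not> (a \<in> M \<or> b \<in> M)"
      then obtain m n :: nat and x r y s where
        x: "x \<in> M" "r \<in> carrier R" "u [^] m = x \<oplus> r \<otimes> a" and
        y: "y \<in> M" "s \<in> carrier R" "u [^] n = y \<oplus> s \<otimes> b"
        using pow[OF ab(1)] pow[OF ab(2)] by blast
      have "u [^] (m + n) = (x \<oplus> r \<otimes> a) \<otimes> (y \<oplus> s \<otimes> b)"
        using u by (simp add: x(3)[symmetric] y(3)[symmetric] nat_pow_mult)
      also have "\<dots> = (x \<otimes> (y \<oplus> s \<otimes> b) \<oplus> (r \<otimes> a) \<otimes> y) \<oplus> (r \<otimes> s) \<otimes> (a \<otimes> b)"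
        using x(1,2) y(1,2) M.Icarr ab(1,2) by (simp add: l_distr r_distr m_ac a_ac)
      also have "\<dots> \<in> M"
      proof (intro M.idealE(2))
        show "x \<otimes> (y \<oplus> s \<otimes> b) \<in> M" by (rule M.idealE(6)) (use x y ab M.Icarr in auto)
        show "(r \<otimes> a) \<otimes> y \<in> M" by (rule M.idealE(5)) (use x y ab in auto)
        show "(r \<otimes> s) \<otimes> (a \<otimes> b) \<in> M" by (rule M.idealE(5)) (use x y ab in auto)
      qed
      finally show False using M(3) by blast
    qed
  qed
  moreover have "u \<notin> M" using M(3)[of 1] u by simp
  ultimately show ?thesis using M(2) by blast
qed

text \<open>
  If the additive order of \<open>1\<close> were \<open>2 j\<close> with \<open>j > 0\<close>, halving \<open>2 j \<cdot> 1 = 0\<close> would give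
  \<open>j \<cdot> 1 = 0\<close>, against minimality.
\<close>

lemma (in cring) odd_char_exponent:
  assumes h: "h \<in> carrier R" "h \<otimes> (\<one> \<oplus> \<one>) = \<one>"
  shows "odd (char_exponent R)"
proof -
  let ?m = "group.ord (add_monoid R) \<one>"
  have dvd: "[n] \<cdot> \<one> = \<zero> \<longleftrightarrow> ?m dvd n" for n :: nat
    using add.pow_eq_id[of \<one> n] by (simp add: add_pow_def)
  have "?m = 0" if ev: "even ?m"
  proof -
    obtain j where j: "?m = 2 * j" using ev by (rule evenE)
    have "[j] \<cdot> \<one> = (h \<otimes> (\<one> \<oplus> \<one>)) \<otimes> ([j] \<cdot> \<one>)" by (simp add: h(2))
    also have "\<dots> = h \<otimes> ([j] \<cdot> \<one> \<oplus> [j] \<cdot> \<one>)" using h(1) by (simp add: m_assoc l_distr)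
    also have "[j] \<cdot> \<one> \<oplus> [j] \<cdot> \<one> = [?m] \<cdot> \<one>"
      using add.nat_pow_mult[of \<one> j j] by (simp add: j mult_2)
    also have "\<dots> = \<zero>" using dvd[of ?m] by simp
    finally have "?m dvd j" using dvd[of j] h by simp
    then have "j = 0 \<or> 2 * j \<le> j" using j dvd_imp_le[of ?m j] by auto
    then show ?thesis using j by simp
  qed
  then show ?thesis by (cases "even ?m") (auto simp: char_exponent_def max_def odd_pos)
qed

text \<open>
  The abstract form of the situation \<open>A = S[It, t\<^sup>2] \<subseteq> S[t]\<close>. The involution \<open>\<sigma>\<close> stands for
  \<open>t \<mapsto> -t\<close>, the ideal \<open>J\<close> for \<open>I S[t]\<close>, and \<open>h\<close> for \<open>1/2\<close>. On \<open>A\<close> the involution is trivial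
  modulo \<open>J\<close>, because the odd coefficients of elements of \<open>A\<close> lie in \<open>I\<close>; and every element of the
  big ring differs from an odd one by an element of \<open>A\<close>, because even polynomials lie in \<open>A\<close>.
\<close>

locale involution_extension = cring R for R (structure) +
  fixes A J \<sigma> h
  assumes A: "subring A R" and J: "ideal J R" and JA: "J \<subseteq> A"
    and hom: "\<sigma> \<in> ring_hom R R" and invol: "\<And>x. x \<in> carrier R \<Longrightarrow> \<sigma> (\<sigma> x) = x"
    and fix_mod: "\<And>x. x \<in> A \<Longrightarrow> x \<ominus> \<sigma> x \<in> J"
    and even_odd: "\<And>x. x \<in> carrier R \<Longrightarrow> \<exists>a \<in> A. \<exists>v \<in> carrier R. \<sigma> v = \<ominus> v \<and> x = a \<oplus> v"
    and half: "h \<in> A" "h \<otimes> (\<one> \<oplus> \<one>) = \<one>"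
begin

abbreviation "E \<equiv> R\<lparr>carrier := A\<rparr>"

lemmas AR = subsetD[OF subringE(1)[OF A]] and Acl = subringE[OF A]
lemmas sigma = ring_hom_memE[OF hom]

lemma sigma_minus: "x \<in> carrier R \<Longrightarrow> \<sigma> (\<ominus> x) = \<ominus> \<sigma> x"
  using ring_hom_cring.hom_a_inv[OF ring_hom_cringI[OF cring_axioms cring_axioms hom]] .

lemma sigma_A: "a \<in> A \<Longrightarrow> \<sigma> a \<in> A"
proof -
  assume a: "a \<in> A"
  have "\<sigma> a = a \<oplus> \<ominus> (a \<ominus> \<sigma> a)" using AR[OF a] sigma(1) by algebra
  moreover have "a \<ominus> \<sigma> a \<in> A" using fix_mod[OF a] JA by blast
  ultimately show ?thesis using a Acl by metis
qed

text \<open>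
  A fixed element \<open>x = a + v\<close> with \<open>v\<close> odd satisfies \<open>2 x = x + \<sigma> x = a + \<sigma> a\<close>, and \<open>\<sigma> a\<close> lies in
  \<open>A\<close> because \<open>a - \<sigma> a \<in> J \<subseteq> A\<close>.
\<close>

lemma fixed_in_A:
  assumes x: "x \<in> carrier R" "\<sigma> x = x"
  shows "x \<in> A"
proof -
  obtain a v where a: "a \<in> A" "v \<in> carrier R" "\<sigma> v = \<ominus> v" "x = a \<oplus> v"
    using even_odd[OF x(1)] by blast
  have hR: "h \<in> carrier R" using half AR by blast
  have "x = (h \<otimes> (\<one> \<oplus> \<one>)) \<otimes> x" using x by (simp add: half)
  also have "\<dots> = h \<otimes> (x \<oplus> \<sigma> x)" using x hR by (simp add: m_assoc l_distr)
  also have "x \<oplus> \<sigma> x = a \<oplus> \<sigma> a"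
    unfolding a(4) using a(1-3) AR sigma by (simp add: r_neg a_ac)
  also have "h \<otimes> (a \<oplus> \<sigma> a) \<in> A" using half(1) a(1) sigma_A Acl by metis
  finally show ?thesis .
qed

lemma sigma_pow: "x \<in> carrier R \<Longrightarrow> \<sigma> (x [^] (n::nat)) = \<sigma> x [^] n"
  by (induction n) (simp_all add: sigma)


lemma two_not_in_prime:
  assumes "primeideal Q R"
  shows "\<one> \<oplus> \<one> \<notin> Q"
proof
  interpret Q: primeideal Q R by fact
  assume "\<one> \<oplus> \<one> \<in> Q"
  then have "h \<otimes> (\<one> \<oplus> \<one>) \<in> Q" using Q.I_l_closed half(1) AR by blast
  then show False using half Q.one_not_in by simp
qed

lemma odd_char_exponent_residue_field:
  assumes P: "primeideal P E"
  shows "odd (char_exponent (residue_field E P))"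
proof -
  interpret P: primeideal P E by fact
  let ?K = "residue_field E P"
  have one: "\<one> \<in> A" "\<one> \<notin> P" using Acl(3) P.one_not_in by simp_all
  have two: "\<one> \<oplus> \<one> \<in> A" using one Acl(7) by blast
  have "\<one>\<^bsub>?K\<^esub> \<oplus>\<^bsub>?K\<^esub> \<one>\<^bsub>?K\<^esub> = residue E P (\<one> \<oplus> \<one>) \<one>"
    using P.residue_add[of \<one> \<one> \<one> \<one>] one unfolding P.residue_one by simp
  then have "residue E P h \<one> \<otimes>\<^bsub>?K\<^esub> (\<one>\<^bsub>?K\<^esub> \<oplus>\<^bsub>?K\<^esub> \<one>\<^bsub>?K\<^esub>) = \<one>\<^bsub>?K\<^esub>"
    using P.residue_mult[of h "\<one> \<oplus> \<one>" \<one> \<one>] one two half unfolding P.residue_one by simp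
  moreover have "residue E P h \<one> \<in> carrier ?K"
    using P.residue_carrier[of h \<one>] one half by simp
  ultimately show ?thesis by (rule cring.odd_char_exponent[OF P.cring_residue_field, rotated])
qed

text \<open>
  Let \<open>u\<close> be odd under the involution. If \<open>u\<close> is not nilpotent modulo \<open>J\<close>, some prime \<open>H \<supseteq> J\<close> of
  the big ring avoids it. The involution fixes \<open>A\<close> modulo \<open>J\<close>, hence fixes \<open>H \<inter> A\<close>, and by
  uniqueness of primes over \<open>H \<inter> A\<close> it fixes the prime \<open>Q\<close> of \<open>C\<close> above it and acts trivially on the
  residue field of \<open>A\<close>. An odd power of \<open>u\<close> lies in that residue field, so it equals its own
  negative; as \<open>2\<close> is invertible, \<open>u\<close> vanishes in the residue field of \<open>Q\<close>.
\<close>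

lemma weakly_subintegral_odd_nilpotent:
  assumes C: "weakly_subintegral R A C" and u: "u \<in> C" "\<sigma> u = \<ominus> u"
  shows "u \<in> ideal_radical R J"
proof (rule ccontr)
  assume not: "u \<notin> ideal_radical R J"
  let ?D = "R\<lparr>carrier := C\<rparr>"
  have sub: "subring C R" and AC: "A \<subseteq> C"
    and bij: "bij_betw (\<lambda>Q. Q \<inter> A) (Spec ?D) (Spec E)"
    and insep: "\<And>Q. Q \<in> Spec ?D \<Longrightarrow>
      purely_inseparable (residue_field E (Q \<inter> A)) (residue_field ?D Q) (residue_map ?D Q)"
    using C by (auto simp: weakly_subintegral_def integral_Spec_bij_def)
  note CR = subsetD[OF subringE(1)[OF sub]] and Ccl = subringE[OF sub]
  have uR: "u \<in> carrier R" using u CR by blast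
  interpret J: ideal J R by (rule J)
  have "u [^] n \<notin> J" for n :: nat
  proof
    assume "u [^] n \<in> J"
    then have "u [^] Suc n \<in> J" using J.I_r_closed uR by simp
    then show False using not uR by (auto simp: ideal_radical_def)
  qed
  then obtain H where H: "primeideal H R" "J \<subseteq> H" "u \<notin> H"
    using exists_prime_avoiding_powers[OF J uR] by blast
  interpret H: primeideal H R by (rule H(1))
  have "H \<inter> A \<in> Spec E" using primeideal_contraction[OF A H(1)] by (simp add: Spec_def)
  then obtain Q where Q: "Q \<in> Spec ?D" and QA: "Q \<inter> A = H \<inter> A"
    using bij unfolding bij_betw_def by (metis (no_types, lifting) imageE)
  interpret Q: primeideal Q ?D using Q by (simp add: Spec_def)
  have JQ: "J \<subseteq> Q" using QA H(2) JA by blast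
  have QC: "x \<in> C" if "x \<in> Q" for x using Q.Icarr[OF that] by simp
  have Qadd: "x \<oplus> y \<in> Q" if "x \<in> Q" "y \<in> Q" for x y using Q.idealE(2)[OF that] by simp
  have Qmult: "x \<otimes> y \<in> Q" if "x \<in> C" "y \<in> Q" for x y using Q.idealE(5)[of x y] that by simp
  have Qneg: "\<ominus> x \<in> Q" if "x \<in> Q" for x
  proof -
    have "(\<ominus> \<one>) \<otimes> x \<in> Q" using Qmult that Ccl by blast
    then show ?thesis using CR[OF QC[OF that]] by (simp add: l_minus)
  qed
  have Qprime: "x \<in> Q \<or> y \<in> Q" if "x \<in> C" "y \<in> C" "x \<otimes> y \<in> Q" for x y
    using Q.I_prime[of x y] that by simp
  have twoA: "\<one> \<oplus> \<one> \<in> A" by (rule Acl(7)[OF Acl(3) Acl(3)])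
  then have twoC: "\<one> \<oplus> \<one> \<in> C" using AC by blast
  have twoQ: "\<one> \<oplus> \<one> \<notin> Q" using two_not_in_prime[OF H(1)] QA twoA by blast
  have uQ: "u \<notin> Q"
  proof
    assume "u \<in> Q"
    then have "u \<otimes> u \<in> Q" using Qmult QC by blast
    moreover have "u \<otimes> u \<in> A"
      using uR u(2) sigma(2) by (intro fixed_in_A) (simp_all add: l_minus r_minus)
    ultimately have "u \<otimes> u \<in> H" using QA by blast
    then show False using H.I_prime uR H(3) by blast
  qed
  have powC: "u [^] n \<in> C" for n :: nat using u Ccl by (induction n) auto
  have powQ: "u [^] n \<notin> Q" for n :: nat
  proof
    assume "u [^] n \<in> Q"
    then have "u [^]\<^bsub>?D\<^esub> n \<in> Q" unfolding nat_pow_consistent[of u n C] .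
    then show False using Q.pow_in_imp_in[of u n] u uQ by simp
  qed
  have sigC: "\<sigma> x \<in> C" if x: "x \<in> C" for x
  proof -
    obtain a v where a: "a \<in> A" "v \<in> carrier R" "\<sigma> v = \<ominus> v" "x = a \<oplus> v"
      using even_odd[OF CR[OF x]] by blast
    have "\<ominus> v = a \<oplus> \<ominus> x" unfolding a(4) using a AR by algebra
    then have "\<ominus> v \<in> C" using Ccl(5,7) x a(1) AC by auto
    moreover have "\<sigma> x = \<sigma> a \<oplus> \<ominus> v" unfolding a(4) using a AR sigma by simp
    ultimately show ?thesis using sigma_A[OF a(1)] AC Ccl(7) by auto
  qed
  (* The conjugate of Q; it lies over the same prime of A, so it is Q. *)
  let ?Q' = "{x \<in> carrier ?D. \<sigma> x \<in> Q}"
  have "\<sigma> \<in> ring_hom ?D ?D"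
    using sigC CR sigma by (auto intro!: ring_hom_memI)
  then have "ring_hom_ring ?D ?D \<sigma>"
    by (intro ring_hom_ringI2 Q.ring_axioms)
  then have "primeideal ?Q' ?D"
    by (rule ring_hom_ring.primeideal_vimage[OF _ Q.cring_axioms Q.primeideal_axioms])
  then have Q': "?Q' \<in> Spec ?D" by (simp add: Spec_def)
  have sigA: "\<sigma> x \<in> Q \<longleftrightarrow> x \<in> Q" if x: "x \<in> A" for x
  proof -
    have xs: "x \<in> carrier R" "\<sigma> x \<in> carrier R" using AR[OF x] sigma(1) by auto
    have d: "x \<ominus> \<sigma> x \<in> Q" using fix_mod[OF x] JQ by blast
    have "x = (x \<ominus> \<sigma> x) \<oplus> \<sigma> x" "\<sigma> x = x \<oplus> \<ominus> (x \<ominus> \<sigma> x)" using xs by algebra+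
    then show ?thesis using Qadd[OF d] Qadd[OF _ Qneg[OF d]] by metis
  qed
  have "?Q' \<inter> A = Q \<inter> A" using sigA AC by auto
  then have "?Q' = Q" using bij Q Q' unfolding bij_betw_def inj_on_def by blast
  then have sigQ: "\<sigma> x \<in> Q" if "x \<in> Q" for x using that by blast
  let ?K = "residue_field E (Q \<inter> A)" and ?L = "residue_field ?D Q"
  have DA: "?D\<lparr>carrier := A\<rparr> = E" by simp
  have subA: "subring A ?D"
    using AC Q.ring_incl_imp_subring[of A] subring_is_ring[OF A] by simp
  have P: "primeideal (Q \<inter> A) E"
    using Q.primeideal_contraction[OF subA Q.primeideal_axioms] by simp
  interpret P: primeideal "Q \<inter> A" E by (rule P)
  have oneC: "\<one> \<in> C" "\<one> \<notin> Q" using Ccl(3) Q.one_not_in by simp_all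
  have "residue ?D Q u \<one> \<in> carrier ?L" using Q.residue_carrier[of u \<one>] u oneC by simp
  then obtain k where k: "residue ?D Q u \<one> [^]\<^bsub>?L\<^esub> (char_exponent ?K ^ k)
      \<in> residue_map ?D Q ` carrier ?K"
    using insep[OF Q] unfolding purely_inseparable_def by blast
  define m where "m = char_exponent ?K ^ k"
  have m: "odd m" using odd_char_exponent_residue_field[OF P] by (simp add: m_def)
  obtain z where z: "z \<in> carrier ?K" "residue ?D Q u \<one> [^]\<^bsub>?L\<^esub> m = residue_map ?D Q z"
    using k unfolding m_def by blast
  obtain r s where r: "r \<in> A" "s \<in> A" "s \<notin> Q" "z = residue E (Q \<inter> A) r s"
    using z(1) by (rule P.residueE) auto
  have rC: "r \<in> C" "s \<in> C" "r \<in> carrier R" "s \<in> carrier R" using r AC AR by auto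
  have "residue_map ?D Q z = residue ?D Q r s"
    unfolding r(4) using Q.residue_map_residue[OF subA Q.primeideal_axioms r(1,2,3)] by simp
  then have "residue ?D Q (u [^] m) \<one> = residue ?D Q r s"
    using z(2) Q.residue_pow[of u m] u nat_pow_consistent[of u m C] by simp
  then have "(u [^] m) \<otimes> s \<ominus>\<^bsub>?D\<^esub> r \<otimes> \<one> \<in> Q"
    using Q.residue_eq_iff[of "u [^] m" r \<one> s] powC rC r oneC by simp
  moreover have "(u [^] m) \<otimes> s \<in> C" by (rule Ccl(6)[OF powC rC(2)])
  ultimately have y: "(u [^] m) \<otimes> s \<ominus> r \<in> Q"
    using a_minus_consistent[OF sub _ rC(1)] rC by simp
  define w where "w = u [^] m"
  have w: "w \<in> carrier R" "w \<in> C" "w \<notin> Q" using uR powC powQ by (simp_all add: w_def)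
  have sw: "\<sigma> w = \<ominus> w"
  proof -
    have "(\<ominus> u) [^] m = \<ominus> (u [^] m)"
    proof -
      obtain j where j: "m = Suc (2 * j)" using m by (auto elim: oddE)
      have "((\<ominus> u) [^] (2::nat)) = u [^] (2::nat)"
        using uR by (simp add: numeral_2_eq_2 l_minus r_minus)
      then have "(\<ominus> u) [^] (2 * j) = u [^] (2 * j)"
        using uR by (metis a_inv_closed nat_pow_pow)
      then show ?thesis using uR by (simp add: j r_minus)
    qed
    then show ?thesis using sigma_pow[OF uR, of m] u(2) by (simp add: w_def)
  qed
  (* w s - r is in Q, and so is its conjugate; their difference is 2 w s modulo J. *)
  let ?y = "w \<otimes> s \<ominus> r"
  have sR: "\<sigma> s \<in> carrier R" "\<sigma> r \<in> carrier R" using rC sigma(1) by auto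
  have sy: "\<sigma> ?y = \<ominus> w \<otimes> \<sigma> s \<oplus> \<ominus> \<sigma> r"
    unfolding a_minus_def using w rC sw sR by (simp add: sigma sigma_minus)
  have "(\<one> \<oplus> \<one>) \<otimes> (w \<otimes> s) = ((?y \<oplus> \<ominus> \<sigma> ?y) \<oplus> w \<otimes> (s \<ominus> \<sigma> s)) \<oplus> (r \<ominus> \<sigma> r)"
    unfolding sy using w(1) rC(3,4) sR by algebra
  moreover have "((?y \<oplus> \<ominus> \<sigma> ?y) \<oplus> w \<otimes> (s \<ominus> \<sigma> s)) \<oplus> (r \<ominus> \<sigma> r) \<in> Q"
  proof (intro Qadd)
    show "?y \<in> Q" using y by (simp add: w_def)
    then show "\<ominus> \<sigma> ?y \<in> Q" by (intro Qneg sigQ)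
    show "w \<otimes> (s \<ominus> \<sigma> s) \<in> Q" using fix_mod[OF r(2)] JQ w by (intro Qmult) auto
    show "r \<ominus> \<sigma> r \<in> Q" using fix_mod[OF r(1)] JQ by auto
  qed
  ultimately have "(\<one> \<oplus> \<one>) \<otimes> (w \<otimes> s) \<in> Q" by simp
  then have "w \<otimes> s \<in> Q" using Qprime[OF twoC Ccl(6)[OF w(2) rC(2)]] twoQ by blast
  then show False using Qprime[OF w(2) rC(2)] w(3) r(3) by blast
qed

end

section \<open>The greatest subintegral extension\<close>

lemma (in cring) cring_subring: "subring S R \<Longrightarrow> cring (R\<lparr>carrier := S\<rparr>)"
  using subcring_iff[OF subringE(1)] subcringI' by blast

lemma (in cring) subintegral_imp_weakly_subintegral:
  assumes "subintegral R A C"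
  shows "weakly_subintegral R A C"
proof -
  have sub: "subring C R" and iso: "\<And>Q. Q \<in> Spec (R\<lparr>carrier := C\<rparr>) \<Longrightarrow>
      residue_map (R\<lparr>carrier := C\<rparr>) Q
        \<in> ring_iso (residue_field (R\<lparr>carrier := A\<rparr>) (Q \<inter> A)) (residue_field (R\<lparr>carrier := C\<rparr>) Q)"
    using assms by (auto simp: subintegral_def integral_Spec_bij_def)
  have "cring (residue_field (R\<lparr>carrier := C\<rparr>) Q)" if "Q \<in> Spec (R\<lparr>carrier := C\<rparr>)" for Q
    using that by (auto simp: Spec_def intro: primeideal.cring_residue_field)
  then show ?thesis
    using assms iso ring_iso_imp_purely_inseparable
    unfolding subintegral_def weakly_subintegral_def by blast
qed

text \<open>
  An extension \<open>C\<close> is determined by its odd elements, which are nilpotent modulo \<open>J\<close> when \<open>C\<close> is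
  weakly subintegral; conversely adjoining all nilpotents modulo \<open>J\<close> is subintegral. Hence the
  subring \<open>adjoin_radical\<close> below is the greatest extension of either kind.
\<close>

locale integral_involution_extension = involution_extension +
  assumes integral: "\<And>x. x \<in> carrier R \<Longrightarrow> integral_over R A x"
begin

definition adjoin_radical where "adjoin_radical = {a \<oplus> w | a w. a \<in> A \<and> w \<in> ideal_radical R J}"

lemma adjoin_radical_props:
  shows "subring adjoin_radical R" "A \<subseteq> adjoin_radical" "ideal_radical R J \<subseteq> adjoin_radical"
proof -
  let ?N = "ideal_radical R J"
  interpret N: ideal ?N R by (rule ideal_ideal_radical[OF J])
  show AG: "A \<subseteq> adjoin_radical"
  proof
    fix a assume a: "a \<in> A"
    then have "a = a \<oplus> \<zero>" using AR by simp
    then show "a \<in> adjoin_radical" unfolding adjoin_radical_def using a N.idealE(1) by blast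
  qed
  show "?N \<subseteq> adjoin_radical"
  proof
    fix w assume w: "w \<in> ?N"
    then have "w = \<zero> \<oplus> w" using N.Icarr by simp
    then show "w \<in> adjoin_radical" unfolding adjoin_radical_def using w Acl(2) by blast
  qed
  show "subring adjoin_radical R"
  proof (rule subringI)
    show "adjoin_radical \<subseteq> carrier R" using AR N.Icarr by (auto simp: adjoin_radical_def)
    show "\<one> \<in> adjoin_radical" using AG Acl(3) by blast
    fix x assume "x \<in> adjoin_radical"
    then obtain a w where a: "a \<in> A" "w \<in> ?N" "x = a \<oplus> w" by (auto simp: adjoin_radical_def)
    show "\<ominus> x \<in> adjoin_radical"
    proof -
      have "\<ominus> x = \<ominus> a \<oplus> \<ominus> w" unfolding a(3) using a AR N.Icarr by (simp add: minus_add)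
      moreover have "\<ominus> w \<in> ?N" using additive_subgroup.a_inv_closed[OF N.is_additive_subgroup a(2)] .
      ultimately show ?thesis unfolding adjoin_radical_def using Acl(5)[OF a(1)] by blast
    qed
    fix y assume "y \<in> adjoin_radical"
    then obtain b v where b: "b \<in> A" "v \<in> ?N" "y = b \<oplus> v" by (auto simp: adjoin_radical_def)
    note c = AR[OF a(1)] AR[OF b(1)] N.Icarr[OF a(2)] N.Icarr[OF b(2)]
    have "x \<oplus> y = (a \<oplus> b) \<oplus> (w \<oplus> v)" unfolding a(3) b(3) using c by algebra
    then show "x \<oplus> y \<in> adjoin_radical" unfolding adjoin_radical_def using Acl(7)[OF a(1) b(1)] N.idealE(2)[OF a(2) b(2)] by blast
    have "x \<otimes> y = (a \<otimes> b) \<oplus> (a \<otimes> v \<oplus> y \<otimes> w)"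
      unfolding a(3) b(3) using c by algebra
    moreover have "a \<otimes> v \<oplus> y \<otimes> w \<in> ?N"
      using c b(3) by (intro N.idealE(2) N.idealE(5) a(2) b(2)) auto
    ultimately show "x \<otimes> y \<in> adjoin_radical" unfolding adjoin_radical_def using Acl(6)[OF a(1) b(1)] by blast
  qed
qed

lemma subintegral_adjoin_radical: "subintegral R A adjoin_radical"
proof -
  let ?N = "ideal_radical R J" and ?D = "R\<lparr>carrier := adjoin_radical\<rparr>"
  interpret N: ideal ?N R by (rule ideal_ideal_radical[OF J])
  interpret J: ideal J R by (rule J)
  note GR = subsetD[OF subringE(1)[OF adjoin_radical_props(1)]]
  interpret D: cring ?D by (rule cring_subring[OF adjoin_radical_props(1)])
  have "ideal_radical ?D J = {f \<in> adjoin_radical. \<exists>n::nat. n > 0 \<and> f [^] n \<in> J}"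
    unfolding ideal_radical_def nat_pow_consistent[symmetric] by simp
  also have "\<dots> = ?N" using adjoin_radical_props(3) GR unfolding ideal_radical_def by blast
  finally have rad: "ideal_radical ?D J = ?N" .
  have subA: "subring A ?D"
    using adjoin_radical_props(2) D.ring_incl_imp_subring[of A] subring_is_ring[OF A] by simp
  have idJ: "ideal J ?D"
  proof (rule D.idealI')
    show "J \<subseteq> carrier ?D" using JA adjoin_radical_props(2) by auto
    show "\<zero>\<^bsub>?D\<^esub> \<in> J" using J.idealE(1) by simp
  next
    fix x y assume "x \<in> J" "y \<in> J"
    then show "x \<oplus>\<^bsub>?D\<^esub> y \<in> J" using J.idealE(2) by simp
  next
    fix r x assume "r \<in> carrier ?D" "x \<in> J"
    then show "r \<otimes>\<^bsub>?D\<^esub> x \<in> J" using J.idealE(5) GR by simp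
  qed
  have "\<exists>a\<in>A. \<exists>w\<in>ideal_radical ?D J. c = a \<oplus>\<^bsub>?D\<^esub> w" if "c \<in> carrier ?D" for c
    unfolding rad using that by (auto simp: adjoin_radical_def)
  then interpret D: conductor_extension ?D A J
    by (intro conductor_extension.intro conductor_extension_axioms.intro
        D.cring_axioms subA idJ JA) simp_all
  show ?thesis
    unfolding subintegral_def integral_Spec_bij_def
    using A adjoin_radical_props GR integral D.Spec_bij D.residue_iso by (auto simp: Spec_def)
qed

lemma weakly_subintegral_subset_adjoin_radical:
  assumes C: "weakly_subintegral R A C"
  shows "C \<subseteq> adjoin_radical"
proof
  fix c assume c: "c \<in> C"
  have sub: "subring C R" and AC: "A \<subseteq> C"
    using C by (auto simp: weakly_subintegral_def integral_Spec_bij_def)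
  have cR: "c \<in> carrier R" using c subringE(1)[OF sub] by blast
  obtain a v where a: "a \<in> A" "v \<in> carrier R" "\<sigma> v = \<ominus> v" "c = a \<oplus> v"
    using even_odd[OF cR] by blast
  have "v = \<ominus> a \<oplus> c" unfolding a(4) using a AR by algebra
  moreover have "\<ominus> a \<in> C" using Acl(5)[OF a(1)] AC by blast
  ultimately have "v \<in> C" using subringE(7)[OF sub] c by simp
  then have "v \<in> ideal_radical R J" using weakly_subintegral_odd_nilpotent[OF C] a(3) by blast
  then show "c \<in> adjoin_radical" using a by (auto simp: adjoin_radical_def)
qed

theorem greatest_subintegral:
  shows "(GREATEST C. subintegral R A C) = adjoin_radical"
    and "(GREATEST C. weakly_subintegral R A C) = adjoin_radical"
proof -
  show "(GREATEST C. subintegral R A C) = adjoin_radical"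
    by (rule Greatest_equality, rule subintegral_adjoin_radical)
      (rule weakly_subintegral_subset_adjoin_radical[OF subintegral_imp_weakly_subintegral])
  show "(GREATEST C. weakly_subintegral R A C) = adjoin_radical"
    by (rule Greatest_equality, rule subintegral_imp_weakly_subintegral[OF subintegral_adjoin_radical])
      (rule weakly_subintegral_subset_adjoin_radical)
qed

lemma adjoin_radical_eq_iff: "A = adjoin_radical \<longleftrightarrow> ideal_radical R J \<subseteq> A"
proof
  show "A = adjoin_radical \<Longrightarrow> ideal_radical R J \<subseteq> A" using adjoin_radical_props(3) by simp
  show "ideal_radical R J \<subseteq> A \<Longrightarrow> A = adjoin_radical" using adjoin_radical_props(2) Acl(7) by (auto simp: adjoin_radical_def)
qed

end

section \<open>Integral elements are almost integral\<close>

text \<open>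
  If \<open>x\<close> is a root of a monic polynomial of degree \<open>m\<close> and \<open>s\<close> is a denominator of \<open>x\<close>, then
  \<open>s\<^sup>m\<close> is a common denominator of \<open>1, x, \<dots>, x\<^sup>m\<close>, and the equation of \<open>x\<close> expresses the higher
  powers through these.
\<close>

lemma (in cring) integral_imp_almost_integral:
  assumes K: "subring K R" and x: "integral_over R K x"
    and s: "s \<in> K" and sx: "s \<otimes> x \<in> K"
  shows "\<exists>m::nat. \<forall>n::nat. s [^] m \<otimes> x [^] n \<in> K"
proof -
  note KR = subsetD[OF subringE(1)[OF K]] and Kcl = subringE[OF K]
  obtain p where p: "set p \<subseteq> K" "eval (\<one> # p) x = \<zero>" and xR: "x \<in> carrier R"
    using x by (auto simp: integral_over_def)
  define d where "d = s [^] length p"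
  have sR: "s \<in> carrier R" and dR: "d \<in> carrier R" using s KR by (simp_all add: d_def)
  have Kpow: "y [^] (n::nat) \<in> K" if "y \<in> K" for y n
    using that Kcl by (induction n) auto
  (* The factor x^k shifts the equation so that it reduces the power n = length p + k. *)
  have ev: "d \<otimes> (eval q x \<otimes> x [^] k) \<in> K"
    if "set q \<subseteq> K" "length q + k \<le> n" "\<And>i. i < n \<Longrightarrow> d \<otimes> x [^] i \<in> K" for q and k n :: nat
    using that(1,2)
  proof (induction q)
    case Nil
    then show ?case using xR dR Kcl by simp
  next
    case (Cons a q)
    have a: "a \<in> K" "set q \<subseteq> carrier R" using Cons.prems KR by auto
    have c: "eval q x \<in> carrier R" using eval_in_carrier a xR by blast
    have "d \<otimes> (eval (a # q) x \<otimes> x [^] k) =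
        a \<otimes> (d \<otimes> x [^] (length q + k)) \<oplus> d \<otimes> (eval q x \<otimes> x [^] k)"
      using a xR dR KR c by (simp add: l_distr r_distr nat_pow_mult[symmetric] m_ac)
    moreover have "d \<otimes> x [^] (length q + k) \<in> K" using that(3) Cons.prems by simp
    moreover have "d \<otimes> (eval q x \<otimes> x [^] k) \<in> K" using Cons by simp
    ultimately show ?case using a Kcl(6,7) by metis
  qed
  have "d \<otimes> x [^] n \<in> K" for n :: nat
  proof (induction n rule: less_induct)
    case (less n)
    show ?case
    proof (cases "n \<le> length p")
      case True
      then have "d \<otimes> x [^] n = s [^] (length p - n) \<otimes> (s \<otimes> x) [^] n"
        using sR xR by (simp add: d_def nat_pow_distrib nat_pow_mult m_assoc[symmetric])
      then show ?thesis using Kpow[OF s] Kpow[OF sx] Kcl(6) by metis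
    next
      case False
      define k where "k = n - length p"
      have n: "n = length p + k" using False by (simp add: k_def)
      have pR: "set p \<subseteq> carrier R" using p(1) KR by blast
      have e: "eval p x \<in> carrier R" using eval_in_carrier pR xR by blast
      have "x [^] length p \<oplus> eval p x = \<zero>" using p(2) xR by simp
      then have "x [^] length p = \<ominus> eval p x"
        using e xR by (simp add: minus_equality minus_minus sum_zero_eq_neg)
      then have "d \<otimes> x [^] n = \<ominus> (d \<otimes> (eval p x \<otimes> x [^] k))"
        using xR dR e by (simp add: n nat_pow_mult[symmetric] l_minus r_minus)
      also have "\<dots> \<in> K" using ev[OF p(1), of k n] less n Kcl(5) by simp
      finally show ?thesis .
    qed
  qed
  then show ?thesis unfolding d_def by blast
qed

section \<open>Polynomial rings are completely integrally closed\<close>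

lemma ring_of_type_algebra_simps [simp]:
  "carrier ring_of_type_algebra = UNIV"
  "x \<otimes>\<^bsub>ring_of_type_algebra\<^esub> y = x * y"
  "x \<oplus>\<^bsub>ring_of_type_algebra\<^esub> y = x + y"
  "\<one>\<^bsub>ring_of_type_algebra\<^esub> = 1"
  "\<zero>\<^bsub>ring_of_type_algebra\<^esub> = 0"
  by (simp_all add: ring_of_type_algebra_def)

lemma uminus_type_algebra [simp]: "\<ominus>\<^bsub>ring_of_type_algebra\<^esub> (x::'a::comm_ring_1) = - x"
proof -
  interpret cring "ring_of_type_algebra :: 'a ring" by (rule cring_from_type_algebra)
  show ?thesis by (rule minus_equality) simp_all
qed

lemma subring_type_algebraI:
  fixes S :: "'a::comm_ring_1 set"
  assumes "1 \<in> S" "\<And>x. x \<in> S \<Longrightarrow> - x \<in> S"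
    "\<And>x y. \<lbrakk>x \<in> S; y \<in> S\<rbrakk> \<Longrightarrow> x + y \<in> S" "\<And>x y. \<lbrakk>x \<in> S; y \<in> S\<rbrakk> \<Longrightarrow> x * y \<in> S"
  shows "subring S ring_of_type_algebra"
  using assms by (intro ring.subringI ring_from_type_algebra) simp_all

lemma subring_type_algebraE:
  fixes S :: "'a::comm_ring_1 set"
  assumes "subring S ring_of_type_algebra"
  shows "0 \<in> S" "1 \<in> S"
    "\<And>x. x \<in> S \<Longrightarrow> - x \<in> S"
    "\<And>x y. \<lbrakk>x \<in> S; y \<in> S\<rbrakk> \<Longrightarrow> x + y \<in> S"
    "\<And>x y. \<lbrakk>x \<in> S; y \<in> S\<rbrakk> \<Longrightarrow> x - y \<in> S"
    "\<And>x y. \<lbrakk>x \<in> S; y \<in> S\<rbrakk> \<Longrightarrow> x * y \<in> S"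
  using subringE(2,3,5-7)[OF assms] by (simp_all, metis uminus_add_conv_diff add.commute)

text \<open>
  Complete integral closedness, phrased without a fraction field: if the powers of the quotient
  \<open>p / q\<close> have a common denominator \<open>d\<close>, then \<open>p / q\<close> lies in \<open>S\<close>. This passes to polynomial rings
  by looking at leading terms only, with no factorization theory.
\<close>

definition completely_integrally_closed :: "'a::idom set \<Rightarrow> bool" where
  "completely_integrally_closed S \<longleftrightarrow>
     (\<forall>d\<in>S. \<forall>p\<in>S. \<forall>q\<in>S. d \<noteq> 0 \<longrightarrow> q \<noteq> 0 \<longrightarrow> (\<forall>n. \<exists>r\<in>S. d * p ^ n = r * q ^ n) \<longrightarrow>
        (\<exists>r\<in>S. p = r * q))"

text \<open>
  Almost integral quotients form a ring: replacing \<open>p / q\<close> by \<open>p / q - k\<close> keeps the common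
  denominator \<open>d\<close>. This is what makes cancelling leading terms possible.
\<close>

lemma almost_integral_diff:
  fixes S :: "'a::comm_ring_1 set"
  assumes S: "subring S ring_of_type_algebra" and k: "k \<in> S"
    and al: "\<And>n. \<exists>r\<in>S. d * p ^ n = r * q ^ n"
  shows "\<exists>r\<in>S. d * (p - k * q) ^ n = r * q ^ n"
proof -
  note S = subring_type_algebraE[OF S]
  have "\<exists>r\<in>S. d * p ^ j * (p - k * q) ^ n = r * q ^ (n + j)" for j
  proof (induction n arbitrary: j)
    case 0
    then show ?case using al by simp
  next
    case (Suc n)
    obtain r where r: "r \<in> S" "d * p ^ Suc j * (p - k * q) ^ n = r * q ^ (n + Suc j)"
      using Suc by blast
    obtain s where s: "s \<in> S" "d * p ^ j * (p - k * q) ^ n = s * q ^ (n + j)" using Suc by blast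
    have "d * p ^ j * (p - k * q) ^ Suc n =
        d * p ^ Suc j * (p - k * q) ^ n - k * q * (d * p ^ j * (p - k * q) ^ n)"
      by (simp add: algebra_simps)
    also have "\<dots> = (r - k * s) * q ^ (Suc n + j)"
      unfolding r(2) s(2) by (simp add: algebra_simps)
    finally show ?case using S(5,6) r s k by metis
  qed
  from this[of 0] show ?thesis by simp
qed

lemma exponent_le_of_multiples:
  assumes "\<And>n::nat. n * b \<le> d + n * a"
  shows "b \<le> (a::nat)"
proof (rule ccontr)
  assume "\<not> b \<le> a"
  then have "Suc d * Suc a \<le> Suc d * b" by (intro mult_le_mono2) simp
  also have "\<dots> \<le> d + Suc d * a" using assms[of "Suc d"] .
  finally show False by simp
qed

definition polys_over :: "'a::zero set \<Rightarrow> 'a poly set" where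
  "polys_over S = {p. \<forall>i. poly.coeff p i \<in> S}"

lemma subring_polys_over:
  fixes S :: "'a::comm_ring_1 set"
  assumes "subring S ring_of_type_algebra"
  shows "subring (polys_over S) ring_of_type_algebra"
proof (rule subring_type_algebraI)
  note S = subring_type_algebraE[OF assms]
  have sum: "(\<Sum>i\<in>B. f i) \<in> S" if "\<And>i. i \<in> B \<Longrightarrow> f i \<in> S" for f :: "nat \<Rightarrow> 'a" and B
    using that S by (induction B rule: infinite_finite_induct) auto
  fix x y assume "x \<in> polys_over S" "y \<in> polys_over S"
  then show "x + y \<in> polys_over S" "x * y \<in> polys_over S"
    using S sum by (auto simp: polys_over_def coeff_mult)
qed (use subring_type_algebraE[OF assms] in \<open>auto simp: polys_over_def coeff_1\<close>)

text \<open>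
  Comparing degrees and leading coefficients in \<open>d p\<^sup>n = r q\<^sup>n\<close> for all \<open>n\<close> shows that the leading
  term of \<open>q\<close> divides that of \<open>p\<close>. Subtracting the quotient term times \<open>q\<close> lowers the degree of \<open>p\<close>
  and keeps the quotient almost integral.
\<close>

theorem completely_integrally_closed_polys_over:
  fixes S :: "'a::idom set"
  assumes S: "subring S ring_of_type_algebra" and cic: "completely_integrally_closed S"
  shows "completely_integrally_closed (polys_over S)"
proof -
  note Sc = subring_type_algebraE[OF S]
  note P = subring_polys_over[OF S]
  note Pc = subring_type_algebraE[OF P]
  have "\<exists>r\<in>polys_over S. p = r * q"
    if d: "d \<in> polys_over S" "d \<noteq> 0" and q: "q \<in> polys_over S" "q \<noteq> 0"
      and p: "p \<in> polys_over S" and al: "\<And>n. \<exists>r\<in>polys_over S. d * p ^ n = r * q ^ n" for d p q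
    using p al
  proof (induction "Polynomial.degree p" arbitrary: p rule: less_induct)
    case less
    show ?case
    proof (cases "p = 0")
      case True
      then show ?thesis using Pc(1) by (intro bexI[of _ 0]) auto
    next
      case False
      let ?deg = "Polynomial.degree" and ?lc = "Polynomial.lead_coeff"
      have al: "\<exists>r\<in>S. ?lc d * ?lc p ^ n = r * ?lc q ^ n"
        and deg: "n * ?deg q \<le> ?deg d + n * ?deg p" for n
      proof -
        obtain r where r: "r \<in> polys_over S" "d * p ^ n = r * q ^ n" using less.prems by blast
        then have "r \<noteq> 0" using d False by auto
        then show "n * ?deg q \<le> ?deg d + n * ?deg p"
          using arg_cong[OF r(2), of ?deg] d q False by (simp add: degree_mult_eq degree_power_eq)
        have "?lc d * ?lc p ^ n = ?lc r * ?lc q ^ n"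
          using arg_cong[OF r(2), of ?lc] by (simp add: lead_coeff_mult lead_coeff_power)
        then show "\<exists>r\<in>S. ?lc d * ?lc p ^ n = r * ?lc q ^ n"
          using r(1) by (auto simp: polys_over_def)
      qed
      have "?lc d \<in> S" "?lc p \<in> S" "?lc q \<in> S" using d q less.prems by (auto simp: polys_over_def)
      then obtain c where c: "c \<in> S" "?lc p = c * ?lc q"
        using cic al d q unfolding completely_integrally_closed_def
        by (metis leading_coeff_0_iff)
      have le: "?deg q \<le> ?deg p" using deg by (rule exponent_le_of_multiples)
      define k where "k = Polynomial.monom c (?deg p - ?deg q)"
      have k: "k \<in> polys_over S" using c Sc by (auto simp: k_def polys_over_def)
      have "c \<noteq> 0" using c False by auto
      then have k0: "k \<noteq> 0" "?deg k = ?deg p - ?deg q" "?lc k = c"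
        by (simp_all add: k_def degree_monom_eq monom_eq_0_iff)
      then have dk: "?deg (k * q) = ?deg p" using q le by (simp add: degree_mult_eq)
      have lk: "?lc (k * q) = ?lc p" unfolding lead_coeff_mult k0(3) c(2) ..
      define p' where "p' = p - k * q"
      have p': "p' \<in> polys_over S" using Pc(5,6) less.prems k q by (simp add: p'_def)
      have al': "\<exists>r\<in>polys_over S. d * p' ^ n = r * q ^ n" for n
        unfolding p'_def by (rule almost_integral_diff[OF P k less.prems(2)])
      have "?deg p' \<le> ?deg p" unfolding p'_def using dk by (metis degree_diff_le order_refl)
      moreover have "poly.coeff p' (?deg p) = 0" using lk unfolding dk by (simp add: p'_def)
      ultimately have "p' = 0 \<or> ?deg p' < ?deg p"
        by (metis le_neq_implies_less leading_coeff_0_iff)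
      then have "\<exists>r\<in>polys_over S. p' = r * q"
        using less.hyps[OF _ p' al'] Pc(1) by fastforce
      then obtain r where r: "r \<in> polys_over S" "p' = r * q" by blast
      then have "p = (r + k) * q" by (simp add: p'_def algebra_simps)
      then show ?thesis using Pc(4)[OF r(1) k] by blast
    qed
  qed
  then show ?thesis unfolding completely_integrally_closed_def by blast
qed

subsection \<open>Leading monomials\<close>

definition leading_term :: "('m::linorder \<Rightarrow>\<^sub>0 'k::zero) \<Rightarrow> 'm \<Rightarrow> 'k \<Rightarrow> bool" where
  "leading_term f a \<alpha> \<longleftrightarrow>
     \<alpha> \<noteq> 0 \<and> Poly_Mapping.lookup f a = \<alpha> \<and> (\<forall>m \<in> Poly_Mapping.keys f. m \<le> a)"

lemma leading_term_exists:
  assumes "f \<noteq> 0"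
  obtains a \<alpha> where "leading_term f a \<alpha>"
proof -
  have "Poly_Mapping.keys f \<noteq> {}" using assms by simp
  then have "Max (Poly_Mapping.keys f) \<in> Poly_Mapping.keys f" by simp
  then have "leading_term f (Max (Poly_Mapping.keys f))
      (Poly_Mapping.lookup f (Max (Poly_Mapping.keys f)))"
    by (auto simp: leading_term_def in_keys_iff)
  then show ?thesis by (rule that)
qed

lemma leading_term_key: "leading_term f a \<alpha> \<Longrightarrow> a \<in> Poly_Mapping.keys f"
  by (auto simp: leading_term_def in_keys_iff)

lemma leading_term_unique:
  assumes "leading_term f a \<alpha>" "leading_term f b \<beta>"
  shows "a = b" "\<alpha> = \<beta>"
proof -
  show "a = b" using assms leading_term_key
    by (metis leading_term_def order_antisym)
  then show "\<alpha> = \<beta>" using assms by (auto simp: leading_term_def)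
qed

lemma leading_term_mult:
  fixes f g :: "'m::{ordered_cancel_comm_monoid_add, linorder} \<Rightarrow>\<^sub>0 'k::idom"
  assumes f: "leading_term f a \<alpha>" and g: "leading_term g b \<beta>"
  shows "leading_term (f * g) (a + b) (\<alpha> * \<beta>)"
proof -
  define f' where "f' = f - Poly_Mapping.single a \<alpha>"
  define g' where "g' = g - Poly_Mapping.single b \<beta>"
  have f': "m < a" if "m \<in> Poly_Mapping.keys f'" for m
    using that f by (auto simp: f'_def in_keys_iff leading_term_def lookup_minus lookup_single when_def
        split: if_splits intro: le_neq_trans)
  have g': "m < b" if "m \<in> Poly_Mapping.keys g'" for m
    using that g by (auto simp: g'_def in_keys_iff leading_term_def lookup_minus lookup_single when_def
        split: if_splits intro: le_neq_trans)
  have gb: "m \<le> b" if "m \<in> Poly_Mapping.keys g" for m using that g by (simp add: leading_term_def)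
  define rest where "rest = Poly_Mapping.single a \<alpha> * g' + f' * g"
  have decomp: "f * g = Poly_Mapping.single (a + b) (\<alpha> * \<beta>) + rest"
    by (simp add: rest_def f'_def g'_def mult_single[symmetric] algebra_simps)
  have rest: "m < a + b" if "m \<in> Poly_Mapping.keys rest" for m
  proof -
    have "m \<in> Poly_Mapping.keys (Poly_Mapping.single a \<alpha> * g') \<or> m \<in> Poly_Mapping.keys (f' * g)"
      using subsetD[OF Poly_Mapping.keys_add that[unfolded rest_def]] by simp
    then show ?thesis
    proof
      assume "m \<in> Poly_Mapping.keys (Poly_Mapping.single a \<alpha> * g')"
      from subsetD[OF keys_mult this] obtain x y where
        "x \<in> Poly_Mapping.keys (Poly_Mapping.single a \<alpha>)" and y: "y \<in> Poly_Mapping.keys g'"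
        and m: "m = x + y" by blast
      then have "x = a" by (simp split: if_splits)
      then show ?thesis unfolding m using add_strict_left_mono[OF g'[OF y]] by simp
    next
      assume "m \<in> Poly_Mapping.keys (f' * g)"
      from subsetD[OF keys_mult this] obtain x y where
        x: "x \<in> Poly_Mapping.keys f'" and y: "y \<in> Poly_Mapping.keys g" and m: "m = x + y" by blast
      show ?thesis unfolding m by (rule add_less_le_mono[OF f'[OF x] gb[OF y]])
    qed
  qed
  have "Poly_Mapping.lookup rest (a + b) = 0"
    using rest[of "a + b"] by (auto simp: in_keys_iff)
  moreover have "m \<le> a + b" if "m \<in> Poly_Mapping.keys (f * g)" for m
  proof -
    have "m \<in> Poly_Mapping.keys (Poly_Mapping.single (a + b) (\<alpha> * \<beta>)) \<or> m \<in> Poly_Mapping.keys rest"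
      using subsetD[OF Poly_Mapping.keys_add that[unfolded decomp]] by simp
    then show ?thesis
    proof
      assume "m \<in> Poly_Mapping.keys (Poly_Mapping.single (a + b) (\<alpha> * \<beta>))"
      then show ?thesis by (simp split: if_splits)
    qed (use rest[of m] in simp)
  qed
  ultimately show ?thesis
    using f g by (auto simp: leading_term_def decomp lookup_add)
qed

lemma leading_term_power:
  fixes f :: "(nat \<Rightarrow>\<^sub>0 nat) \<Rightarrow>\<^sub>0 'k::idom"
  assumes "leading_term f a \<alpha>"
  shows "\<exists>b. leading_term (f ^ n) b (\<alpha> ^ n) \<and>
    (\<forall>i. Poly_Mapping.lookup b i = n * Poly_Mapping.lookup a i)"
proof (induction n)
  case 0
  have "leading_term (1 :: (nat \<Rightarrow>\<^sub>0 nat) \<Rightarrow>\<^sub>0 'k) 0 1"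
    by (auto simp: leading_term_def lookup_one)
  then show ?case by (intro exI[of _ 0]) auto
next
  case (Suc n)
  then obtain b where "leading_term (f ^ n) b (\<alpha> ^ n)"
    "\<forall>i. Poly_Mapping.lookup b i = n * Poly_Mapping.lookup a i" by blast
  then show ?case
    using leading_term_mult[OF assms, of "f ^ n" b "\<alpha> ^ n"]
    by (intro exI[of _ "a + b"]) (auto simp: lookup_add)
qed

text \<open>
  The order on monomials is lexicographic, so it is well-founded only when the number of
  variables is bounded: it then embeds into the lexicographic order on lists of a fixed length.
\<close>

lemma wf_monomials:
  "wf {(a :: nat \<Rightarrow>\<^sub>0 nat, b). a < b \<and> Poly_Mapping.keys b \<subseteq> {..<n}}"
proof (rule wf_subset)
  let ?L = "\<lambda>a :: nat \<Rightarrow>\<^sub>0 nat. map (Poly_Mapping.lookup a) [0..<n]"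
  show "wf (inv_image (lexn less_than n) ?L)" by (simp add: wf_lexn)
  show "{(a, b). a < b \<and> Poly_Mapping.keys b \<subseteq> {..<n}} \<subseteq> inv_image (lexn less_than n) ?L"
  proof safe
    fix a b :: "nat \<Rightarrow>\<^sub>0 nat"
    assume less: "a < b" and keys: "Poly_Mapping.keys b \<subseteq> {..<n}"
    obtain k where k: "Poly_Mapping.lookup a k < Poly_Mapping.lookup b k"
      "\<And>k'. k' < k \<Longrightarrow> Poly_Mapping.lookup a k' = Poly_Mapping.lookup b k'"
      using less by (auto simp: less_poly_mapping.rep_eq less_fun_def)
    have "k \<in> Poly_Mapping.keys b" using k(1) by (simp add: in_keys_iff)
    then have "k < n" using keys by auto
    then have upt: "[0..<n] = [0..<k] @ k # [Suc k..<n]"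
      by (metis less_imp_le_nat plus_nat.add_0 upt_add_eq_append upt_conv_Cons le_iff_add)
    have "?L a = map (Poly_Mapping.lookup b) [0..<k] @ Poly_Mapping.lookup a k #
        map (Poly_Mapping.lookup a) [Suc k..<n]"
      using k(2) by (simp add: upt)
    moreover have "?L b = map (Poly_Mapping.lookup b) [0..<k] @ Poly_Mapping.lookup b k #
        map (Poly_Mapping.lookup b) [Suc k..<n]"
      by (simp add: upt)
    ultimately show "(a, b) \<in> inv_image (lexn less_than n) ?L"
      using k(1) \<open>k < n\<close> by (auto simp: lexn_conv)
  qed
qed

lemma subring_mpoly_ring:
  "subring (carrier (mpoly_ring n)) (ring_of_type_algebra :: 'k::comm_ring_1 mpoly ring)"
proof (rule subring_type_algebraI)
  fix x y :: "'k mpoly"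
  assume xy: "x \<in> carrier (mpoly_ring n)" "y \<in> carrier (mpoly_ring n)"
  show "x + y \<in> carrier (mpoly_ring n)"
    using xy Poly_Mapping.keys_add[of x y] by (auto simp: mpoly_ring_def)
  show "x * y \<in> carrier (mpoly_ring n)"
  proof -
    have "Poly_Mapping.keys m \<subseteq> {..<n}" if m: "m \<in> Poly_Mapping.keys (x * y)" for m
    proof -
      from subsetD[OF keys_mult m] obtain a b where
        a: "a \<in> Poly_Mapping.keys x" and b: "b \<in> Poly_Mapping.keys y" and ab: "m = a + b" by blast
      have "Poly_Mapping.keys a \<subseteq> {..<n}" "Poly_Mapping.keys b \<subseteq> {..<n}"
        using xy a b by (simp_all add: mpoly_ring_def)
      then show ?thesis unfolding ab using Poly_Mapping.keys_add[of a b] by blast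
    qed
    then show ?thesis by (simp add: mpoly_ring_def)
  qed
qed (auto simp: mpoly_ring_def)

text \<open>
  The same cancellation of leading terms as for polynomials in one variable, with the
  lexicographic order in place of the degree. Leading coefficients are units here.
\<close>

theorem completely_integrally_closed_mpoly_ring:
  "completely_integrally_closed (carrier (mpoly_ring n) :: 'k::field mpoly set)"
proof -
  let ?S = "carrier (mpoly_ring n) :: 'k mpoly set"
  note S = subring_mpoly_ring[where 'k = 'k and n = n]
  note Sc = subring_type_algebraE[OF S]
  let ?lk = "Poly_Mapping.lookup"
  have keys: "Poly_Mapping.keys a \<subseteq> {..<n}" if "f \<in> ?S" "leading_term f a \<alpha>" for f a \<alpha>
    using that leading_term_key[OF that(2)] by (auto simp: mpoly_ring_def)
  have main: "\<exists>r\<in>?S. p = r * q"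
    if d: "d \<in> ?S" "d \<noteq> 0" and q: "q \<in> ?S" "q \<noteq> 0"
      and p: "p \<in> ?S" and al: "\<And>n. \<exists>r\<in>?S. d * p ^ n = r * q ^ n"
      and lp: "leading_term p a \<alpha>" for d p q a \<alpha>
    using p al lp
  proof (induction a arbitrary: p \<alpha> rule: wf_induct_rule[OF wf_monomials[of n]])
    case (1 a)
    obtain e \<delta> where ld: "leading_term d e \<delta>" using leading_term_exists[OF d(2)] .
    obtain b \<beta> where lq: "leading_term q b \<beta>" using leading_term_exists[OF q(2)] .
    have "n * ?lk b i \<le> ?lk e i + n * ?lk a i" for n i
    proof -
      obtain r where r: "r \<in> ?S" "d * p ^ n = r * q ^ n" using 1(3) by blast
      obtain a' where a': "leading_term (p ^ n) a' (\<alpha> ^ n)" "\<And>i. ?lk a' i = n * ?lk a i"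
        using leading_term_power[OF 1(4)] by blast
      obtain b' where b': "leading_term (q ^ n) b' (\<beta> ^ n)" "\<And>i. ?lk b' i = n * ?lk b i"
        using leading_term_power[OF lq] by blast
      have "leading_term (d * p ^ n) (e + a') (\<delta> * \<alpha> ^ n)" by (rule leading_term_mult[OF ld a'(1)])
      then have "r \<noteq> 0" using r(2) by (auto simp: leading_term_def)
      then obtain c \<gamma> where lr: "leading_term r c \<gamma>" by (rule leading_term_exists)
      have "e + a' = c + b'"
        using leading_term_unique(1) leading_term_mult[OF ld a'(1)] leading_term_mult[OF lr b'(1)] r(2)
        by metis
      then have "?lk e i + n * ?lk a i = ?lk c i + n * ?lk b i"
        using a'(2) b'(2) by (metis lookup_add)
      then show ?thesis by linarith
    qed
    then have le: "?lk b i \<le> ?lk a i" for i by (rule exponent_le_of_multiples)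
    define m where "m = a - b"
    have mb: "m + b = a"
      using le by (intro poly_mapping_eqI) (simp add: m_def lookup_add lookup_minus)
    have "Poly_Mapping.keys m \<subseteq> Poly_Mapping.keys a"
      by (auto simp: m_def in_keys_iff lookup_minus)
    then have keysm: "Poly_Mapping.keys m \<subseteq> {..<n}" using keys[OF 1(2,4)] by blast
    define k where "k = Poly_Mapping.single m (\<alpha> / \<beta>)"
    have k: "k \<in> ?S" using keysm by (auto simp: k_def mpoly_ring_def)
    have nz: "\<alpha> \<noteq> 0" "\<beta> \<noteq> 0" using 1(4) lq by (auto simp: leading_term_def)
    then have "leading_term k m (\<alpha> / \<beta>)" by (auto simp: k_def leading_term_def)
    from leading_term_mult[OF this lq] have lkq: "leading_term (k * q) a \<alpha>" using nz by (simp add: mb)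
    define p' where "p' = p - k * q"
    have p': "p' \<in> ?S" using Sc(5,6) 1(2) k q by (simp add: p'_def)
    have al': "\<exists>r\<in>?S. d * p' ^ n = r * q ^ n" for n
      unfolding p'_def by (rule almost_integral_diff[OF S k 1(3)])
    have "\<exists>r\<in>?S. p' = r * q"
    proof (cases "p' = 0")
      case True
      then show ?thesis using Sc(1) by (intro bexI[of _ 0]) auto
    next
      case False
      then obtain a' \<alpha>' where lp': "leading_term p' a' \<alpha>'" by (rule leading_term_exists)
      have key: "a' \<in> Poly_Mapping.keys p'" by (rule leading_term_key[OF lp'])
      then have "a' \<in> Poly_Mapping.keys p \<or> a' \<in> Poly_Mapping.keys (k * q)"
        by (auto simp: p'_def in_keys_iff lookup_minus)
      then have "a' \<le> a" using 1(4) lkq by (auto simp: leading_term_def)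
      moreover have "?lk p' a = 0" using 1(4) lkq by (simp add: p'_def leading_term_def lookup_minus)
      then have "a' \<noteq> a" using key by (auto simp: in_keys_iff)
      ultimately have "(a', a) \<in> {(a, b). a < b \<and> Poly_Mapping.keys b \<subseteq> {..<n}}"
        using keys[OF 1(2,4)] by auto
      then show ?thesis by (rule 1(1)[OF _ p' al' lp'])
    qed
    then obtain r where r: "r \<in> ?S" "p' = r * q" by blast
    then have "p = (r + k) * q" by (simp add: p'_def algebra_simps)
    then show ?case using Sc(4)[OF r(1) k] by blast
  qed
  show ?thesis
    unfolding completely_integrally_closed_def
  proof (intro ballI impI)
    fix d p q :: "'k mpoly"
    assume h: "d \<in> ?S" "p \<in> ?S" "q \<in> ?S" "d \<noteq> 0" "q \<noteq> 0" "\<forall>n. \<exists>r\<in>?S. d * p ^ n = r * q ^ n"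
    show "\<exists>r\<in>?S. p = r * q"
    proof (cases "p = 0")
      case True
      then show ?thesis using Sc(1) by (intro bexI[of _ 0]) auto
    next
      case False
      then obtain a \<alpha> where "leading_term p a \<alpha>" by (rule leading_term_exists)
      then show ?thesis using main[of d q p a \<alpha>] h by blast
    qed
  qed
qed

section \<open>The normalization of a subring with a conductor\<close>

lemma (in cring) fraction_pow:
  assumes "a \<in> carrier R" "s \<in> nonzerodivisors R"
  shows "fraction R a s [^]\<^bsub>total_fractions R\<^esub> (n::nat) = fraction R (a [^] n) (s [^] n)"
    and "s [^] n \<in> nonzerodivisors R"
proof -
  have s: "s [^] n \<in> nonzerodivisors R" for n :: nat
    by (induction n) (simp_all add: one_nonzerodivisor nonzerodivisors_mult assms)
  show "fraction R a s [^]\<^bsub>total_fractions R\<^esub> n = fraction R (a [^] n) (s [^] n)"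
    by (induction n) (simp_all add: fraction_one fraction_mult s assms)
  show "s [^] n \<in> nonzerodivisors R" by (rule s)
qed

text \<open>
  The normalization of \<open>A\<close> is identified with a concrete ring \<open>R\<close> that is integral over \<open>A\<close>. The
  element \<open>f\<close> is a denominator common to all elements of \<open>R\<close>, so \<open>x \<mapsto> f x / f\<close> maps \<open>R\<close> to fractions
  over \<open>A\<close>; the assumption \<open>closed\<close> says that \<open>R\<close> contains every quotient of elements of \<open>A\<close> whose
  powers have a power of \<open>q\<close> as common denominator.
\<close>

locale conductor_overring = "domain" R for R (structure) +
  fixes A f
  assumes A: "subring A R" and f: "f \<in> A" "f \<noteq> \<zero>"
    and conductor: "\<And>x. x \<in> carrier R \<Longrightarrow> f \<otimes> x \<in> A"
    and integral_over_A: "\<And>x. x \<in> carrier R \<Longrightarrow> integral_over R A x"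
    and closed: "\<And>p q m. \<lbrakk>p \<in> A; q \<in> A; q \<noteq> \<zero>;
      \<And>n::nat. \<exists>b\<in>A. q [^] (m::nat) \<otimes> p [^] n = b \<otimes> q [^] n\<rbrakk> \<Longrightarrow> \<exists>r\<in>carrier R. p = r \<otimes> q"
begin

abbreviation "E \<equiv> R\<lparr>carrier := A\<rparr>"
abbreviation "K \<equiv> total_fractions E"

definition to_fraction :: "'a \<Rightarrow> ('a \<times> 'a) set" where
  "to_fraction x = fraction E (f \<otimes> x) f"

lemmas AR = subsetD[OF subringE(1)[OF A]] and Acl = subringE[OF A]

sublocale E: "domain" E by (rule subring_is_domain[OF A])
sublocale K: cring K by (rule E.cring_total_fractions)

lemma nonzerodivisors_E: "nonzerodivisors E = A - {\<zero>}"
  using E.nonzerodivisors_domain by simp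

lemma fraction_E_eq_iff:
  assumes "a \<in> A" "b \<in> A" "s \<in> A" "t \<in> A" "s \<noteq> \<zero>" "t \<noteq> \<zero>"
  shows "fraction E a s = fraction E b t \<longleftrightarrow> a \<otimes> t = b \<otimes> s"
  using E.fraction_eq_iff[of a b s t] assms by (simp add: nonzerodivisors_E)

lemma to_fraction_hom: "to_fraction \<in> ring_hom R K"
proof (rule ring_hom_memI)
  note fR = AR[OF f(1)]
  have ff: "f \<otimes> f \<in> A" "f \<otimes> f \<noteq> \<zero>" using f fR Acl(6) integral by auto
  note c = conductor
  fix x assume x: "x \<in> carrier R"
  show "to_fraction x \<in> carrier K"
    unfolding to_fraction_def using E.fraction_in_carrier[of "f \<otimes> x" f] c[OF x] f
    by (simp add: nonzerodivisors_E)
  fix y assume y: "y \<in> carrier R"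
  have "to_fraction x \<otimes>\<^bsub>K\<^esub> to_fraction y = fraction E ((f \<otimes> x) \<otimes> (f \<otimes> y)) (f \<otimes> f)"
    unfolding to_fraction_def
    using E.fraction_mult[of "f \<otimes> x" "f \<otimes> y" f f] c x y f by (simp add: nonzerodivisors_E)
  also have "\<dots> = to_fraction (x \<otimes> y)"
    unfolding to_fraction_def
    using x y fR fraction_E_eq_iff[OF Acl(6)[OF c[OF x] c[OF y]] c[OF m_closed[OF x y]] ff(1) f(1) ff(2) f(2)]
    by (simp add: m_ac)
  finally show "to_fraction (x \<otimes> y) = to_fraction x \<otimes>\<^bsub>K\<^esub> to_fraction y" ..
  have "to_fraction x \<oplus>\<^bsub>K\<^esub> to_fraction y =
      fraction E ((f \<otimes> x) \<otimes> f \<oplus> (f \<otimes> y) \<otimes> f) (f \<otimes> f)"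
    unfolding to_fraction_def
    using E.fraction_add[of "f \<otimes> x" "f \<otimes> y" f f] c x y f by (simp add: nonzerodivisors_E)
  also have "\<dots> = to_fraction (x \<oplus> y)"
    unfolding to_fraction_def
    using x y fR fraction_E_eq_iff[OF Acl(7)[OF Acl(6)[OF c[OF x] f(1)] Acl(6)[OF c[OF y] f(1)]]
        c[OF a_closed[OF x y]] ff(1) f(1) ff(2) f(2)]
    by (simp add: l_distr r_distr m_ac)
  finally show "to_fraction (x \<oplus> y) = to_fraction x \<oplus>\<^bsub>K\<^esub> to_fraction y" ..
next
  show "to_fraction \<one> = \<one>\<^bsub>K\<^esub>"
    unfolding to_fraction_def E.fraction_one
    using f AR Acl(3) by (simp add: fraction_E_eq_iff)
qed

lemma to_fraction_A: "a \<in> A \<Longrightarrow> to_fraction a = fraction_embed E a"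
  unfolding to_fraction_def fraction_embed_def
  using f AR Acl(3,6) by (simp add: fraction_E_eq_iff m_ac)

lemma to_fraction_inj: "inj_on to_fraction (carrier R)"
proof (rule inj_onI)
  fix x y assume xy: "x \<in> carrier R" "y \<in> carrier R" "to_fraction x = to_fraction y"
  note fR = AR[OF f(1)]
  have "f \<otimes> x \<otimes> f = f \<otimes> y \<otimes> f"
    using xy conductor f by (simp add: to_fraction_def fraction_E_eq_iff)
  then have "f \<otimes> x = f \<otimes> y" using m_rcancel[of f "f \<otimes> x" "f \<otimes> y"] f fR xy by simp
  then show "x = y" using m_lcancel[of f x y] f fR xy by simp
qed

lemma embed_image: "fraction_embed E ` carrier E = to_fraction ` A"
  using to_fraction_A by simp

lemma to_fraction_ring_hom: "ring_hom_ring R K to_fraction"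
  by (intro ring_hom_ringI2 ring_axioms K.ring_axioms to_fraction_hom)

lemma subring_embed: "subring (to_fraction ` A) K"
  by (rule ring_hom_ring.img_is_subring[OF to_fraction_ring_hom A])

text \<open>
  An integral fraction \<open>a / s\<close> is almost integral with common denominator \<open>s\<^sup>m\<close>. Clearing
  denominators turns this into the divisibilities that \<open>closed\<close> asks for.
\<close>

lemma integral_over_iff:
  "integral_over K (to_fraction ` A) x \<longleftrightarrow> x \<in> to_fraction ` carrier R"
proof
  assume int: "integral_over K (to_fraction ` A) x"
  then have "x \<in> carrier K" by (simp add: integral_over_def)
  then obtain a s where a: "a \<in> A" and sn: "s \<in> nonzerodivisors E" and x: "x = fraction E a s"
    by (auto elim: E.total_fractionsE)
  have s: "s \<in> A" "s \<noteq> \<zero>" using sn by (simp_all add: nonzerodivisors_E)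
  have one: "\<one> \<in> nonzerodivisors E" "\<one> \<in> A" using Acl(3) by (simp_all add: nonzerodivisors_E)
  have spow: "s [^] n \<in> A" "s [^] n \<noteq> \<zero>" for n :: nat
    using E.fraction_pow(2)[OF _ sn, of a n] a nat_pow_consistent[of s n A]
    by (simp_all add: nonzerodivisors_E)
  have apow: "a [^] n \<in> A" for n :: nat
    using E.nat_pow_closed[of a n] a nat_pow_consistent[of a n A] by simp
  have "to_fraction s \<otimes>\<^bsub>K\<^esub> x = fraction E (s \<otimes> a) s"
    unfolding to_fraction_A[OF s(1)] fraction_embed_def x
    using E.fraction_mult[of s a \<one> s] a s sn one AR by simp
  also have "\<dots> = to_fraction a"
    unfolding to_fraction_A[OF a] fraction_embed_def
    using a s one AR Acl(6) by (subst fraction_E_eq_iff) (simp_all add: m_ac)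
  finally have sx: "to_fraction s \<otimes>\<^bsub>K\<^esub> x \<in> to_fraction ` A" using a by simp
  obtain m :: nat where m: "\<And>n::nat. to_fraction s [^]\<^bsub>K\<^esub> m \<otimes>\<^bsub>K\<^esub> x [^]\<^bsub>K\<^esub> n \<in> to_fraction ` A"
    using K.integral_imp_almost_integral[OF subring_embed int _ sx] s(1) by blast
  have "\<exists>b\<in>A. s [^] m \<otimes> a [^] n = b \<otimes> s [^] n" for n :: nat
  proof -
    obtain b where b: "b \<in> A"
      and eq: "to_fraction s [^]\<^bsub>K\<^esub> m \<otimes>\<^bsub>K\<^esub> x [^]\<^bsub>K\<^esub> n = to_fraction b"
      using m[of n] by blast
    have "to_fraction s [^]\<^bsub>K\<^esub> m = fraction E (s [^] m) \<one>"
      unfolding to_fraction_A[OF s(1)] fraction_embed_def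
      using E.fraction_pow(1)[of s \<one> m] s one
        nat_pow_consistent[of s m A] nat_pow_consistent[of \<one> m A] by simp
    moreover have "x [^]\<^bsub>K\<^esub> n = fraction E (a [^] n) (s [^] n)"
      unfolding x using E.fraction_pow(1)[of a s n] a sn
        nat_pow_consistent[of s n A] nat_pow_consistent[of a n A] by simp
    ultimately have "fraction E (s [^] m \<otimes> a [^] n) (s [^] n) = fraction E b \<one>"
      using eq E.fraction_mult[of "s [^] m" "a [^] n" \<one> "s [^] n"] spow apow one AR
      unfolding to_fraction_A[OF b] fraction_embed_def by (simp add: nonzerodivisors_E)
    then have "s [^] m \<otimes> a [^] n \<otimes> \<one> = b \<otimes> s [^] n"
      using fraction_E_eq_iff[of "s [^] m \<otimes> a [^] n" b "s [^] n" \<one>] spow apow one b Acl(6) by simp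
    then show ?thesis using b spow apow AR by auto
  qed
  then obtain r where r: "r \<in> carrier R" "a = r \<otimes> s" using closed[OF a s] by blast
  have "x = to_fraction r"
    unfolding x to_fraction_def
    using fraction_E_eq_iff[OF a conductor[OF r(1)] s(1) f(1) s(2) f(2)] r AR[OF s(1)] AR[OF f(1)]
    by (simp add: m_ac)
  then show "x \<in> to_fraction ` carrier R" using r by blast
next
  assume "x \<in> to_fraction ` carrier R"
  then obtain y where y: "y \<in> carrier R" "x = to_fraction y" by blast
  obtain p where p: "set p \<subseteq> A" "eval (\<one> # p) y = \<zero>"
    using integral_over_A[OF y(1)] by (auto simp: integral_over_def)
  have pR: "set (\<one> # p) \<subseteq> carrier R" using p AR by auto
  interpret h: ring_hom_ring R K to_fraction by (rule to_fraction_ring_hom)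
  have "K.eval (\<one>\<^bsub>K\<^esub> # map to_fraction p) x = \<zero>\<^bsub>K\<^esub>"
    using h.eval_hom'[OF y(1) pR] p(2) y(2) by simp
  moreover have "set (map to_fraction p) \<subseteq> to_fraction ` A" using p(1) by auto
  moreover have "x \<in> carrier K" using y by simp
  ultimately show "integral_over K (to_fraction ` A) x"
    unfolding integral_over_def by blast
qed

lemma normalization_eq: "normalization E = K\<lparr>carrier := to_fraction ` carrier R\<rparr>"
proof -
  have "{x. integral_over K (to_fraction ` A) x} = to_fraction ` carrier R"
    using integral_over_iff by blast
  then show ?thesis unfolding normalization_def embed_image by simp
qed

lemma subring_normalization: "subring (to_fraction ` carrier R) K"
  by (rule ring_hom_ring.img_is_subring[OF to_fraction_ring_hom carrier_is_subring])

lemma cring_normalization: "cring (normalization E)"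
  unfolding normalization_eq by (rule K.cring_subring[OF subring_normalization])

lemma to_fraction_iso: "to_fraction \<in> ring_iso R (normalization E)"
  unfolding normalization_eq
  using ring_hom_memE[OF to_fraction_hom] to_fraction_inj
  by (intro ring_iso_memI) (auto simp: bij_betw_def)

lemma integral_over_normalization:
  assumes "x \<in> carrier (normalization E)"
  shows "integral_over (normalization E) (to_fraction ` A) x"
proof -
  have "x \<in> to_fraction ` carrier R" using assms by (simp add: normalization_eq)
  then have "integral_over K (to_fraction ` A) x" by (simp only: integral_over_iff)
  then obtain p where "set p \<subseteq> to_fraction ` A" "K.eval (\<one>\<^bsub>K\<^esub> # p) x = \<zero>\<^bsub>K\<^esub>"
    unfolding integral_over_def by blast
  moreover have "ring.eval (normalization E) = K.eval"
    unfolding normalization_eq by (rule K.eval_consistent[OF subring_normalization])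
  moreover have "\<one>\<^bsub>normalization E\<^esub> = \<one>\<^bsub>K\<^esub>" "\<zero>\<^bsub>normalization E\<^esub> = \<zero>\<^bsub>K\<^esub>"
    by (simp_all add: normalization_eq)
  ultimately show ?thesis unfolding integral_over_def using assms by metis
qed

end

section \<open>Normality notions through the radical of a conductor ideal\<close>

lemma (in cring) ideal_radical_iso:
  assumes B: "cring B" and iso: "\<phi> \<in> ring_iso R B" and J: "J \<subseteq> carrier R"
  shows "ideal_radical B (\<phi> ` J) = \<phi> ` ideal_radical R J"
proof -
  interpret B: cring B by fact
  have hom: "\<phi> \<in> ring_hom R B" and bij: "bij_betw \<phi> (carrier R) (carrier B)"
    using iso by (auto simp: ring_iso_def)
  interpret ring_hom_ring R B \<phi> by (intro ring_hom_ringI2 ring_axioms B.ring_axioms hom)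
  have inj: "inj_on \<phi> (carrier R)" and im: "carrier B = \<phi> ` carrier R"
    using bij by (auto simp: bij_betw_def)
  have "\<phi> x [^]\<^bsub>B\<^esub> n \<in> \<phi> ` J \<longleftrightarrow> x [^] n \<in> J" if "x \<in> carrier R" for x and n :: nat
    using hom_nat_pow[OF that, of n, symmetric] inj_on_image_mem_iff[OF inj _ J, of "x [^] n"] that
    by simp
  then have "(\<exists>n::nat. n > 0 \<and> \<phi> x [^]\<^bsub>B\<^esub> n \<in> \<phi> ` J) \<longleftrightarrow> (\<exists>n::nat. n > 0 \<and> x [^] n \<in> J)"
    if "x \<in> carrier R" for x using that by blast
  then show ?thesis unfolding ideal_radical_def im by blast
qed

text \<open>
  The normalization is a ring of equivalence classes of fractions. The involution is easy to
  describe only on an isomorphic ring, and is conjugated with the isomorphism.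
\<close>

lemma (in involution_extension) transport:
  assumes B: "cring B" and iso: "\<phi> \<in> ring_iso R B"
  shows "involution_extension B (\<phi> ` A) (\<phi> ` J) (\<lambda>y. \<phi> (\<sigma> (inv_into (carrier R) \<phi> y))) (\<phi> h)"
proof -
  let ?s = "\<lambda>y. \<phi> (\<sigma> (inv_into (carrier R) \<phi> y))"
  interpret B: cring B by fact
  interpret J: ideal J R by (rule J)
  have hom: "\<phi> \<in> ring_hom R B" and bij: "bij_betw \<phi> (carrier R) (carrier B)"
    using iso by (auto simp: ring_iso_def)
  interpret phi: ring_hom_ring R B \<phi> by (intro ring_hom_ringI2 ring_axioms B.ring_axioms hom)
  have inj: "inj_on \<phi> (carrier R)" and im: "carrier B = \<phi> ` carrier R"
    using bij by (auto simp: bij_betw_def)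
  note m = ring_hom_memE[OF hom]
  have s: "?s (\<phi> x) = \<phi> (\<sigma> x)" if "x \<in> carrier R" for x
    using inv_into_f_f[OF inj that] by simp
  have minus: "\<phi> (x \<ominus> y) = \<phi> x \<ominus>\<^bsub>B\<^esub> \<phi> y" if "x \<in> carrier R" "y \<in> carrier R" for x y
    using that by (simp add: a_minus_def B.minus_eq)
  show ?thesis
  proof (intro involution_extension.intro involution_extension_axioms.intro)
    show "cring B" by (rule B)
    show "subring (\<phi> ` A) B" by (rule phi.img_is_subring[OF A])
    show "ideal (\<phi> ` J) B"
    proof (rule B.idealI')
      show "\<phi> ` J \<subseteq> carrier B" using J.Icarr by auto
      show "\<zero>\<^bsub>B\<^esub> \<in> \<phi> ` J" using J.idealE(1) phi.hom_zero by (metis imageI)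
    next
      fix x y assume "x \<in> \<phi> ` J" "y \<in> \<phi> ` J"
      then obtain a b where "a \<in> J" "b \<in> J" "x = \<phi> a" "y = \<phi> b" by blast
      then show "x \<oplus>\<^bsub>B\<^esub> y \<in> \<phi> ` J"
        using J.idealE(2)[of a b] J.Icarr m(3)[of a b] by (metis imageI)
    next
      fix r x assume "r \<in> carrier B" "x \<in> \<phi> ` J"
      then obtain a b where "a \<in> carrier R" "b \<in> J" "r = \<phi> a" "x = \<phi> b" using im by blast
      then show "r \<otimes>\<^bsub>B\<^esub> x \<in> \<phi> ` J"
        using J.idealE(5)[of a b] J.Icarr m(2)[of a b] by (metis imageI)
    qed
    show "\<phi> ` J \<subseteq> \<phi> ` A" using JA by blast
    show "?s \<in> ring_hom B B"
    proof (rule ring_hom_memI)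
      fix x assume "x \<in> carrier B"
      then obtain a where a: "a \<in> carrier R" "x = \<phi> a" using im by blast
      show "?s x \<in> carrier B" unfolding a(2) s[OF a(1)] using a sigma by simp
      fix y assume "y \<in> carrier B"
      then obtain b where b: "b \<in> carrier R" "y = \<phi> b" using im by blast
      have "?s (x \<otimes>\<^bsub>B\<^esub> y) = \<phi> (\<sigma> (a \<otimes> b))" using a b m s[of "a \<otimes> b"] by simp
      then show "?s (x \<otimes>\<^bsub>B\<^esub> y) = ?s x \<otimes>\<^bsub>B\<^esub> ?s y" using a b m s sigma by simp
      have "?s (x \<oplus>\<^bsub>B\<^esub> y) = \<phi> (\<sigma> (a \<oplus> b))" using a b m s[of "a \<oplus> b"] by simp
      then show "?s (x \<oplus>\<^bsub>B\<^esub> y) = ?s x \<oplus>\<^bsub>B\<^esub> ?s y" using a b m s sigma by simp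
    next
      show "?s \<one>\<^bsub>B\<^esub> = \<one>\<^bsub>B\<^esub>" using s[of \<one>] sigma m by simp
    qed
    fix x assume "x \<in> carrier B"
    then obtain a where a: "a \<in> carrier R" "x = \<phi> a" using im by blast
    show "?s (?s x) = x" using a s sigma invol by simp
    obtain b v where b: "b \<in> A" "v \<in> carrier R" "\<sigma> v = \<ominus> v" "a = b \<oplus> v"
      using even_odd[OF a(1)] by blast
    have "?s (\<phi> v) = \<ominus>\<^bsub>B\<^esub> \<phi> v" unfolding s[OF b(2)] using b by simp
    moreover have "x = \<phi> b \<oplus>\<^bsub>B\<^esub> \<phi> v" using a b AR m by simp
    ultimately show "\<exists>a\<in>\<phi> ` A. \<exists>v\<in>carrier B. ?s v = \<ominus>\<^bsub>B\<^esub> v \<and> x = a \<oplus>\<^bsub>B\<^esub> v"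
      using b(1,2) m(1) by blast
  next
    fix x assume "x \<in> \<phi> ` A"
    then obtain a where a: "a \<in> A" "x = \<phi> a" by blast
    have "x \<ominus>\<^bsub>B\<^esub> ?s x = \<phi> (a \<ominus> \<sigma> a)"
      unfolding a(2) s[OF AR[OF a(1)]] using minus AR[OF a(1)] sigma by simp
    then show "x \<ominus>\<^bsub>B\<^esub> ?s x \<in> \<phi> ` J" using fix_mod[OF a(1)] by simp
  next
    show "\<phi> h \<in> \<phi> ` A" using half by blast
    have "\<phi> (h \<otimes> (\<one> \<oplus> \<one>)) = \<phi> h \<otimes>\<^bsub>B\<^esub> (\<one>\<^bsub>B\<^esub> \<oplus>\<^bsub>B\<^esub> \<one>\<^bsub>B\<^esub>)"
      using AR[OF half(1)] m(2)[of h "\<one> \<oplus> \<one>"] m(3)[of \<one> \<one>] m(4) by simp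
    then show "\<phi> h \<otimes>\<^bsub>B\<^esub> (\<one>\<^bsub>B\<^esub> \<oplus>\<^bsub>B\<^esub> \<one>\<^bsub>B\<^esub>) = \<one>\<^bsub>B\<^esub>" using half m by simp
  qed
qed

text \<open>
  In the normalization, \<open>A\<close> enlarged by the radical of \<open>J\<close> is the greatest subintegral as well as the
  greatest weakly subintegral extension of \<open>A\<close>. So both normality notions say that the radical of
  \<open>J\<close> adds nothing to \<open>A\<close>.
\<close>

theorem seminormal_iff_radical_subset:
  assumes "involution_extension R A J \<sigma> h" and "conductor_overring R A f"
  shows "seminormal (R\<lparr>carrier := A\<rparr>) \<longleftrightarrow> ideal_radical R J \<subseteq> A"
    and "weakly_normal (R\<lparr>carrier := A\<rparr>) \<longleftrightarrow> ideal_radical R J \<subseteq> A"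
proof -
  interpret invext: involution_extension R A J \<sigma> h by fact
  interpret over: conductor_overring R A f by fact
  let ?E = "R\<lparr>carrier := A\<rparr>" and ?\<phi> = "over.to_fraction"
  let ?B = "normalization ?E"
  interpret B: integral_involution_extension ?B "?\<phi> ` A" "?\<phi> ` J"
      "\<lambda>y. ?\<phi> (\<sigma> (inv_into (carrier R) ?\<phi> y))" "?\<phi> h"
    by (intro integral_involution_extension.intro integral_involution_extension_axioms.intro
        invext.transport over.cring_normalization over.to_fraction_iso
        over.integral_over_normalization)
  have JR: "J \<subseteq> carrier R" using invext.JA invext.AR by blast
  have "?\<phi> ` A = B.adjoin_radical \<longleftrightarrow> ?\<phi> ` ideal_radical R J \<subseteq> ?\<phi> ` A"
    unfolding B.adjoin_radical_eq_iff
    using invext.ideal_radical_iso[OF over.cring_normalization over.to_fraction_iso JR] by simp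
  also have "\<dots> \<longleftrightarrow> ideal_radical R J \<subseteq> A"
  proof -
    have "w \<in> A" if "w \<in> ideal_radical R J" "?\<phi> w \<in> ?\<phi> ` A" for w
      using that inj_on_image_mem_iff[OF over.to_fraction_inj _ subringE(1)[OF over.A], of w]
      by (simp add: ideal_radical_def)
    then show ?thesis by blast
  qed
  finally have eq: "?\<phi> ` A = B.adjoin_radical \<longleftrightarrow> ideal_radical R J \<subseteq> A" .
  show "seminormal ?E \<longleftrightarrow> ideal_radical R J \<subseteq> A"
    unfolding seminormal_def seminormalization_def over.embed_image B.greatest_subintegral(1) by (rule eq)
  show "weakly_normal ?E \<longleftrightarrow> ideal_radical R J \<subseteq> A"
    unfolding weakly_normal_def weak_normalization_def over.embed_image B.greatest_subintegral(2)
    by (rule eq)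
qed

section \<open>Rees-like algebras\<close>

lemma type_algebra_pow: "x [^]\<^bsub>ring_of_type_algebra\<lparr>carrier := T\<rparr>\<^esub> n = (x :: 'a::comm_ring_1) ^ n"
  by (induction n) (simp_all add: nat_pow_def mult.commute)

lemma domain_type_algebra: "domain (ring_of_type_algebra :: 'a::idom ring)"
  by (intro domain.intro domain_axioms.intro cring_from_type_algebra) auto

lemma uminus_type_subring:
  fixes T :: "'a::comm_ring_1 set"
  assumes "subring T ring_of_type_algebra" "x \<in> T"
  shows "\<ominus>\<^bsub>ring_of_type_algebra\<lparr>carrier := T\<rparr>\<^esub> x = - x"
proof -
  interpret ring "ring_of_type_algebra\<lparr>carrier := T\<rparr>"
    by (rule ring.subring_is_ring[OF ring_from_type_algebra assms(1)])
  show ?thesis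
    using assms(2) subring_type_algebraE(3)[OF assms(1)] by (intro minus_equality) simp_all
qed

definition reflect :: "'a::comm_ring_1 poly \<Rightarrow> 'a poly" where
  "reflect p = pcompose p [:0, - 1:]"

lemma coeff_reflect: "poly.coeff (reflect p) i = (if even i then poly.coeff p i else - poly.coeff p i)"
  by (simp add: reflect_def coeff_pcompose_linear)

lemma reflect_simps:
  "reflect (p + q) = reflect p + reflect q" "reflect (p - q) = reflect p - reflect q"
  "reflect (p * q) = reflect p * reflect q" "reflect (- p) = - reflect p"
  "reflect 1 = 1" "reflect [:c:] = [:c:]"
  by (simp_all add: reflect_def pcompose_add pcompose_diff pcompose_mult pcompose_uminus pcompose_1)

lemma reflect_reflect: "reflect (reflect p) = p"
  by (rule poly_eqI) (simp add: coeff_reflect)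

text \<open>
  Here \<open>S\<close> stands for the polynomial ring in the variables other than \<open>t\<close>, and \<open>h\<close> for \<open>1/2\<close>.
\<close>

locale rees_data =
  fixes S I :: "'a::idom set" and h :: 'a
  assumes S: "subring S ring_of_type_algebra" and S_closed: "completely_integrally_closed S"
    and I: "I \<subseteq> S" "0 \<in> I" "\<And>x y. \<lbrakk>x \<in> I; y \<in> I\<rbrakk> \<Longrightarrow> x + y \<in> I"
      "\<And>r x. \<lbrakk>r \<in> S; x \<in> I\<rbrakk> \<Longrightarrow> r * x \<in> I"
    and half: "h \<in> S" "h * 2 = 1"
begin

text \<open>
  A product of generators of \<open>S[It, t\<^sup>2]\<close> has odd degree in \<open>t\<close> only if a factor from \<open>It\<close> occurs.
  So the Rees-like algebra consists of the polynomials with odd coefficients in \<open>I\<close>.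
\<close>

definition A where "A = {p \<in> polys_over S. \<forall>i. odd i \<longrightarrow> poly.coeff p i \<in> I}"

lemmas Scl = subring_type_algebraE[OF S]
lemmas St = subring_polys_over[OF S]
lemmas Stcl = subring_type_algebraE[OF St]

lemma I_uminus: "x \<in> I \<Longrightarrow> - x \<in> I"
  using I(4)[of "- 1" x] Scl(2,3) by simp

lemma I_sum: "(\<And>i. i \<in> B \<Longrightarrow> g i \<in> I) \<Longrightarrow> (\<Sum>i\<in>B. g i) \<in> I"
  using I(2,3) by (induction B rule: infinite_finite_induct) auto

lemma It_ideal:
  shows "polys_over I \<subseteq> polys_over S" "0 \<in> polys_over I"
    "\<And>x y. \<lbrakk>x \<in> polys_over I; y \<in> polys_over I\<rbrakk> \<Longrightarrow> x + y \<in> polys_over I"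
    "\<And>x y. \<lbrakk>x \<in> polys_over I; y \<in> polys_over I\<rbrakk> \<Longrightarrow> x - y \<in> polys_over I"
    "\<And>r x. \<lbrakk>r \<in> polys_over S; x \<in> polys_over I\<rbrakk> \<Longrightarrow> r * x \<in> polys_over I"
proof -
  fix x y assume xy: "x \<in> polys_over I" "y \<in> polys_over I"
  show "x - y \<in> polys_over I"
    using xy I(3)[OF _ I_uminus] by (fastforce simp: polys_over_def)
next
  fix r x assume "r \<in> polys_over S" "x \<in> polys_over I"
  then show "r * x \<in> polys_over I" using I(4) by (auto simp: polys_over_def coeff_mult intro: I_sum)
qed (use I in \<open>auto simp: polys_over_def\<close>)

lemma subring_A: "subring A ring_of_type_algebra"
proof (rule subring_type_algebraI)
  show "1 \<in> A" using Stcl(2) I(2) by (auto simp: A_def coeff_1)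
  fix x assume x: "x \<in> A"
  show "- x \<in> A" using x Stcl(3) I_uminus by (simp add: A_def)
  fix y assume y: "y \<in> A"
  show "x + y \<in> A" using x y Stcl(4) I(3) by (simp add: A_def)
  have co: "poly.coeff z i \<in> S" "odd i \<Longrightarrow> poly.coeff z i \<in> I" if "z \<in> A" for z i
    using that by (simp_all add: A_def polys_over_def)
  have "poly.coeff x i * poly.coeff y (n - i) \<in> I" if n: "odd n" "i \<le> n" for n i
  proof (cases "odd i")
    case True
    from I(4)[OF co(1)[OF y] co(2)[OF x True]] show ?thesis by (simp only: mult.commute)
  next
    case False
    then have "odd (n - i)" using n by simp
    from I(4)[OF co(1)[OF x] co(2)[OF y this]] show ?thesis .
  qed
  then have "poly.coeff (x * y) n \<in> I" if "odd n" for n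
    unfolding coeff_mult using that by (intro I_sum) simp
  moreover have "x * y \<in> polys_over S" using x y by (intro Stcl(6)) (simp_all add: A_def)
  ultimately show "x * y \<in> A" by (simp add: A_def)
qed

lemmas Acl = subring_type_algebraE[OF subring_A]

lemma half_add: "h * (c + c) = (c::'a)"
proof -
  have "h * (c + c) = h * 2 * c" by (simp only: mult_2 mult.assoc)
  then show ?thesis using half by simp
qed

lemma two_cancel: "- (c::'a) = c \<Longrightarrow> c = 0"
  using half_add[of c] by (metis add.right_inverse mult_zero_right)

lemma fixed_in_A: "\<lbrakk>p \<in> polys_over S; reflect p = p\<rbrakk> \<Longrightarrow> p \<in> A"
proof -
  assume p: "p \<in> polys_over S" "reflect p = p"
  have "poly.coeff p i = 0" if "odd i" for i
    using arg_cong[OF p(2), of "\<lambda>q. poly.coeff q i"] that by (intro two_cancel) (simp add: coeff_reflect)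
  then show ?thesis using p I(2) by (simp add: A_def)
qed

lemma reflect_St: "p \<in> polys_over S \<Longrightarrow> reflect p \<in> polys_over S"
  using Scl(3) by (simp add: polys_over_def coeff_reflect)

lemma reflect_A: "p \<in> A \<Longrightarrow> reflect p \<in> A"
  using reflect_St I_uminus by (simp add: A_def coeff_reflect)

text \<open>
  The normalization of \<open>A\<close>. If \<open>I = 0\<close> then \<open>A = S[t\<^sup>2]\<close>, whose fractions do not contain \<open>t\<close>, and
  \<open>A\<close> is normal.
\<close>

definition T where "T = (if I = {0} then A else polys_over S)"

lemma A_subset: "A \<subseteq> polys_over S"
  by (auto simp: A_def)

lemma T: "subring T ring_of_type_algebra" "A \<subseteq> T" "T \<subseteq> polys_over S"
  "p \<in> T \<Longrightarrow> reflect p \<in> T"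
proof -
  have TA: "T = A \<or> T = polys_over S" unfolding T_def by metis
  show "subring T ring_of_type_algebra" using TA subring_A St by metis
  show "A \<subseteq> T" "T \<subseteq> polys_over S" using TA A_subset by blast+
  show "p \<in> T \<Longrightarrow> reflect p \<in> T" using TA reflect_A reflect_St by blast
qed

lemmas Tcl = subring_type_algebraE[OF T(1)]

abbreviation "R \<equiv> ring_of_type_algebra\<lparr>carrier := T\<rparr>"

lemma domain_R: "domain R"
  by (rule domain.subring_is_domain[OF domain_type_algebra T(1)])

lemma subring_A_R: "subring A R"
proof -
  interpret domain R by (rule domain_R)
  show ?thesis
    using ring.subring_is_ring[OF ring_from_type_algebra subring_A] T(2)
    by (intro ring_incl_imp_subring) simp_all
qed

lemma It_A: "polys_over I \<subseteq> A"
  using It_ideal(1) by (auto simp: A_def polys_over_def)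

lemma minus_R: "\<lbrakk>x \<in> T; y \<in> T\<rbrakk> \<Longrightarrow> x \<ominus>\<^bsub>R\<^esub> y = x - y"
  by (simp add: a_minus_def uminus_type_subring[OF T(1)])

lemma half_A: "[:h:] \<in> A"
  using half Scl I by (auto simp: A_def polys_over_def coeff_pCons split: nat.splits)

lemma half_double: "[:h:] * (p + p) = (p :: 'a poly)"
  by (rule poly_eqI) (simp only: mult_pCons_left mult_zero_left pCons_0_0 add_0_right
      coeff_smult coeff_add half_add)

lemma involution: "involution_extension R A (polys_over I) reflect [:h:]"
proof (intro involution_extension.intro involution_extension_axioms.intro)
  interpret domain R by (rule domain_R)
  show "cring R" by (rule is_cring)
  show "subring A R" by (rule subring_A_R)
  show "polys_over I \<subseteq> A" by (rule It_A)
  show "ideal (polys_over I) R"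
    using It_ideal It_A T by (intro idealI') auto
  show "reflect \<in> ring_hom R R"
    using T(4) by (intro ring_hom_memI) (simp_all add: reflect_simps)
  show "[:h:] \<in> A" by (rule half_A)
  show "[:h:] \<otimes>\<^bsub>R\<^esub> (\<one>\<^bsub>R\<^esub> \<oplus>\<^bsub>R\<^esub> \<one>\<^bsub>R\<^esub>) = \<one>\<^bsub>R\<^esub>" using half_double[of 1] by simp
next
  fix x assume "x \<in> carrier R"
  then show "reflect (reflect x) = x" by (simp add: reflect_reflect)
next
  fix x assume x: "x \<in> A"
  have "2 * c \<in> I" if "c \<in> I" for c using I(3)[OF that that] by (simp only: mult_2)
  then have "x - reflect x \<in> polys_over I"
    using x I(2) by (auto simp: polys_over_def A_def coeff_reflect)
  then show "x \<ominus>\<^bsub>R\<^esub> reflect x \<in> polys_over I" using x T minus_R by auto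
next
  fix x assume "x \<in> carrier R"
  then have x: "x \<in> T" by simp
  define a v where "a = [:h:] * (x + reflect x)" and "v = [:h:] * (x - reflect x)"
  have h: "[:h:] \<in> T" using half_A T by blast
  have aT: "a \<in> T" "v \<in> T" using x T(4) h Tcl by (simp_all add: a_def v_def del: mult_pCons_left)
  have "reflect a = a"
    by (simp add: a_def reflect_simps reflect_reflect add.commute del: mult_pCons_left)
  then have "a \<in> A" using aT T by (intro fixed_in_A) auto
  moreover have "reflect v = - v"
  proof -
    have "reflect v = [:h:] * - (x - reflect x)"
      by (simp only: v_def reflect_simps reflect_reflect minus_diff_eq)
    then show ?thesis by (simp only: v_def mult_minus_right)
  qed
  then have "reflect v = \<ominus>\<^bsub>R\<^esub> v" using uminus_type_subring[OF T(1) aT(2)] by simp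
  moreover have "a + v = [:h:] * (x + x)" unfolding a_def v_def by (simp only: ring_distribs) simp
  then have "x = a \<oplus>\<^bsub>R\<^esub> v" using half_double[of x] by simp
  ultimately show "\<exists>a\<in>A. \<exists>v\<in>carrier R. reflect v = \<ominus>\<^bsub>R\<^esub> v \<and> x = a \<oplus>\<^bsub>R\<^esub> v"
    using aT by auto
qed

text \<open>
  The quotient exists in \<open>S[t]\<close> because \<open>S[t]\<close> is completely integrally closed. If \<open>I = 0\<close>, it
  is a quotient of even polynomials and therefore even itself.
\<close>

lemma almost_integral_in_T:
  assumes p: "p \<in> A" "q \<in> A" "q \<noteq> 0" and al: "\<And>n. \<exists>b\<in>A. q ^ m * p ^ n = b * q ^ n"
  shows "\<exists>r\<in>T. p = r * q"
proof -
  have qm: "q ^ m \<in> A" using p Acl by (induction m) auto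
  have "completely_integrally_closed (polys_over S)"
    by (rule completely_integrally_closed_polys_over[OF S S_closed])
  moreover have "\<forall>n. \<exists>b\<in>polys_over S. q ^ m * p ^ n = b * q ^ n"
    using al by (auto simp: A_def)
  moreover have "p \<in> polys_over S" "q \<in> polys_over S" "q ^ m \<in> polys_over S" "q ^ m \<noteq> 0"
    using p qm by (auto simp: A_def)
  ultimately obtain r where r: "r \<in> polys_over S" "p = r * q"
    using p(3) unfolding completely_integrally_closed_def by blast
  show ?thesis
  proof (cases "I = {0}")
    case True
    have even: "reflect x = x" if x: "x \<in> A" for x
    proof -
      have "poly.coeff x i = 0" if "odd i" for i
      proof -
        have "poly.coeff x i \<in> I" using x that unfolding A_def by blast
        then show ?thesis using True by blast
      qed
      then show ?thesis by (intro poly_eqI) (simp add: coeff_reflect)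
    qed
    have "reflect r * q = r * q"
      using even[OF p(1)] even[OF p(2)] r(2) by (metis reflect_simps(3))
    then have "reflect r = r" using p(3) by simp
    then have "r \<in> A" using r by (intro fixed_in_A)
    then show ?thesis using r T(2) by blast
  next
    case False
    then show ?thesis using r by (auto simp: T_def)
  qed
qed

text \<open>
  Each \<open>x\<close> is a root of \<open>(X - x) (X - \<sigma> x)\<close>, whose coefficients are fixed by \<open>\<sigma>\<close>.
\<close>

lemma integral_over_A:
  assumes x: "x \<in> T"
  shows "integral_over R A x"
proof -
  interpret domain R by (rule domain_R)
  define s m where "s = x + reflect x" and "m = x * reflect x"
  have "s \<in> A" "m \<in> A"
    using x T Stcl reflect_St unfolding s_def m_def
    by (auto intro!: fixed_in_A simp: reflect_simps reflect_reflect add.commute mult.commute)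
  then have "set [- s, m] \<subseteq> A" using Acl(3) by simp
  moreover have "eval (\<one>\<^bsub>R\<^esub> # [- s, m]) x = \<zero>\<^bsub>R\<^esub>"
    by (simp add: type_algebra_pow s_def m_def power2_eq_square algebra_simps)
  ultimately show ?thesis unfolding integral_over_def using x by fastforce
qed

text \<open>
  A nonzero element of \<open>I\<close> carries \<open>S[t]\<close> into \<open>I S[t] \<subseteq> A\<close>.
\<close>

lemma conductor_element:
  obtains f where "f \<in> A" "f \<noteq> 0" "\<And>x. x \<in> T \<Longrightarrow> f * x \<in> A"
proof (cases "I = {0}")
  case True
  have "T = A" unfolding T_def by (rule if_P[OF True])
  then show ?thesis using Acl(2) by (intro that[of 1]) simp_all
next
  case False
  then obtain g where g: "g \<in> I" "g \<noteq> 0" using I(2) by blast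
  then have gI: "[:g:] \<in> polys_over I"
    using I(2) by (auto simp: polys_over_def coeff_pCons split: nat.splits)
  show ?thesis
  proof (rule that)
    show "[:g:] \<in> A" using gI It_A by blast
    fix x assume "x \<in> T"
    then have "x * [:g:] \<in> polys_over I" using It_ideal(5)[OF _ gI] T by blast
    then show "[:g:] * x \<in> A" using It_A by (simp add: mult.commute subset_iff)
  qed (use g in simp)
qed

text \<open>
  The leading coefficient of a polynomial with a power in \<open>I S[t]\<close> has a power in \<open>I\<close>. If \<open>I\<close> is
  radical, the leading term can therefore be removed without changing the hypothesis, because
  congruent polynomials have congruent powers.
\<close>

lemma radical_It:
  assumes rad: "\<And>g m. \<lbrakk>g \<in> S; g ^ m \<in> I\<rbrakk> \<Longrightarrow> g \<in> I"
    and p: "p \<in> polys_over S" "p ^ m \<in> polys_over I"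
  shows "p \<in> polys_over I"
  using p
proof (induction "Polynomial.degree p" arbitrary: p rule: less_induct)
  case less
  let ?d = "Polynomial.degree p" and ?c = "Polynomial.lead_coeff p"
  have cS: "?c \<in> S" using less.prems by (simp add: polys_over_def)
  have "?c ^ m \<in> I"
    using less.prems(2) by (simp add: polys_over_def flip: lead_coeff_power)
  then have c: "?c \<in> I" using rad[OF cS] by blast
  define k where "k = Polynomial.monom ?c ?d"
  have k: "k \<in> polys_over I" using c I(2) by (simp add: k_def polys_over_def)
  define q where "q = p - k"
  have q: "q \<in> polys_over S" using less.prems(1) k It_ideal(1) Stcl(5) by (auto simp: q_def)
  have "p ^ j - q ^ j \<in> polys_over I" for j
  proof (induction j)
    case (Suc j)
    have "p ^ Suc j - q ^ Suc j = p * (p ^ j - q ^ j) + q ^ j * k"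
      by (simp add: q_def algebra_simps)
    moreover have "q ^ j \<in> polys_over S" using q Stcl by (induction j) auto
    ultimately show ?case using It_ideal(3,5) Suc less.prems(1) k by simp
  qed (simp add: It_ideal)
  then have "p ^ m - (p ^ m - q ^ m) \<in> polys_over I" using It_ideal(4) less.prems(2) by blast
  then have qm: "q ^ m \<in> polys_over I" by simp
  have "Polynomial.degree q \<le> ?d"
    unfolding q_def k_def by (intro degree_diff_le) (simp_all add: degree_monom_le)
  moreover have "poly.coeff q ?d = 0" by (simp add: q_def k_def)
  ultimately have "q = 0 \<or> Polynomial.degree q < ?d"
    by (metis le_neq_implies_less leading_coeff_0_iff)
  then have "q \<in> polys_over I" using less.hyps[OF _ q qm] It_ideal(2) by blast
  then have "q + k \<in> polys_over I" using k It_ideal(3) by blast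
  then show ?case by (simp add: q_def)
qed

lemma ideal_radical_R:
  "ideal_radical R (polys_over I) = {p \<in> T. \<exists>m>0. p ^ m \<in> polys_over I}"
  by (simp add: ideal_radical_def type_algebra_pow)

text \<open>
  If \<open>g\<^sup>m \<in> I\<close>, then \<open>g t\<close> is nilpotent modulo \<open>I S[t]\<close>; it lies in \<open>A\<close> only if \<open>g \<in> I\<close>.
\<close>

lemma radical_subset_A_iff:
  "ideal_radical R (polys_over I) \<subseteq> A \<longleftrightarrow> {g \<in> S. \<exists>m>0. g ^ m \<in> I} = I"
proof
  assume rad: "{g \<in> S. \<exists>m>0. g ^ m \<in> I} = I"
  have "g \<in> I" if "g \<in> S" "g ^ m \<in> I" for g and m :: nat
  proof -
    have "g ^ Suc m \<in> I" using that I(4) by simp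
    then show ?thesis using that rad by blast
  qed
  then have "p \<in> polys_over I" if "p \<in> ideal_radical R (polys_over I)" for p
    using that radical_It T by (auto simp: ideal_radical_R)
  then show "ideal_radical R (polys_over I) \<subseteq> A" using It_A by blast
next
  assume rad: "ideal_radical R (polys_over I) \<subseteq> A"
  have "g \<in> I" if g: "g \<in> S" "m > 0" "g ^ m \<in> I" for g and m :: nat
  proof (cases "I = {0}")
    case True
    then show ?thesis using g by simp
  next
    case False
    let ?x = "Polynomial.monom g 1"
    have "?x \<in> polys_over S" using g Scl by (simp add: polys_over_def)
    then have "?x \<in> T" using False by (simp add: T_def)
    moreover have "?x ^ m \<in> polys_over I" using g I(2) by (simp add: polys_over_def monom_power)
    ultimately have "?x \<in> A" using rad g(2) by (auto simp: ideal_radical_R)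
    then have "poly.coeff ?x 1 \<in> I" unfolding A_def using odd_one by blast
    then show ?thesis by simp
  qed
  moreover have "g \<in> S \<and> (\<exists>m>0. g ^ m \<in> I)" if "g \<in> I" for g
    using that I(1) by (auto intro!: exI[of _ "1::nat"])
  ultimately show "{g \<in> S. \<exists>m>0. g ^ m \<in> I} = I" by blast
qed

theorem seminormal_iff_radical:
  shows "seminormal (ring_of_type_algebra\<lparr>carrier := A\<rparr>) \<longleftrightarrow> {g \<in> S. \<exists>m>0. g ^ m \<in> I} = I"
    and "weakly_normal (ring_of_type_algebra\<lparr>carrier := A\<rparr>) \<longleftrightarrow> {g \<in> S. \<exists>m>0. g ^ m \<in> I} = I"
proof -
  obtain f where f: "f \<in> A" "f \<noteq> 0" "\<And>x. x \<in> T \<Longrightarrow> f * x \<in> A"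
    using conductor_element by blast
  have "conductor_overring R A f"
  proof (intro conductor_overring.intro conductor_overring_axioms.intro)
    show "domain R" by (rule domain_R)
    show "subring A R" by (rule subring_A_R)
  next
    fix p q and m :: nat
    assume "p \<in> A" "q \<in> A" "q \<noteq> \<zero>\<^bsub>R\<^esub>"
      "\<And>n::nat. \<exists>b\<in>A. q [^]\<^bsub>R\<^esub> m \<otimes>\<^bsub>R\<^esub> p [^]\<^bsub>R\<^esub> n = b \<otimes>\<^bsub>R\<^esub> q [^]\<^bsub>R\<^esub> n"
    then show "\<exists>r\<in>carrier R. p = r \<otimes>\<^bsub>R\<^esub> q"
      using almost_integral_in_T[of p q m] by (simp add: type_algebra_pow)
  qed (use f integral_over_A in simp_all)
  from seminormal_iff_radical_subset[OF involution this]
  show "seminormal (ring_of_type_algebra\<lparr>carrier := A\<rparr>) \<longleftrightarrow> {g \<in> S. \<exists>m>0. g ^ m \<in> I} = I"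
    and "weakly_normal (ring_of_type_algebra\<lparr>carrier := A\<rparr>) \<longleftrightarrow> {g \<in> S. \<exists>m>0. g ^ m \<in> I} = I"
    by (simp_all add: radical_subset_A_iff)
qed

lemma A_eq_generate_ring:
  "A = generate_ring (ring_of_type_algebra\<lparr>carrier := polys_over S\<rparr>)
     ((\<lambda>f. [:f:]) ` S \<union> (\<lambda>f. [:0, f:]) ` I \<union> {[:0, 0, 1:]})" (is "_ = generate_ring ?P ?H")
proof
  interpret P: ring ?P by (rule ring.subring_is_ring[OF ring_from_type_algebra St])
  have HA: "?H \<subseteq> A"
    using I Scl by (auto simp: A_def polys_over_def coeff_pCons split: nat.splits)
  have AP: "A \<subseteq> polys_over S" by (auto simp: A_def)
  have "carrier ?P = polys_over S" by simp
  then have HP: "?H \<subseteq> carrier ?P" using subset_trans[OF HA AP] by (simp only:)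
  have "subring A ?P"
    using ring.subring_is_ring[OF ring_from_type_algebra subring_A] AP
    by (intro P.ring_incl_imp_subring) simp_all
  then show "generate_ring ?P ?H \<subseteq> A" by (rule P.generate_ring_min_subring1[OF HP _ HA])
  have G: "subring (generate_ring ?P ?H) ?P" by (rule P.generate_ring_is_subring[OF HP])
  have Gcl: "x + y \<in> generate_ring ?P ?H" "x * y \<in> generate_ring ?P ?H"
    if "x \<in> generate_ring ?P ?H" "y \<in> generate_ring ?P ?H" for x y
    using subringE(6,7)[OF G that] by simp_all
  have G01: "0 \<in> generate_ring ?P ?H" "1 \<in> generate_ring ?P ?H" using subringE(2,3)[OF G] by simp_all
  have t2: "Polynomial.monom 1 (2 * j) \<in> generate_ring ?P ?H" for j
  proof (induction j)
    case 0
    then show ?case using G01 by (simp flip: one_pCons)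
  next
    case (Suc j)
    have "[:0, 0, 1:] \<in> generate_ring ?P ?H" by (rule generate_ring.incl) simp
    from Gcl(2)[OF this Suc] show ?case by (simp add: monom_altdef mult.commute)
  qed
  have mono: "Polynomial.monom (poly.coeff p i) i \<in> generate_ring ?P ?H" if p: "p \<in> A" for p i
  proof (cases "even i")
    case True
    then obtain j where i: "i = 2 * j" by (rule evenE)
    have "[:poly.coeff p i:] \<in> generate_ring ?P ?H"
      using p by (intro generate_ring.incl) (auto simp: A_def polys_over_def)
    from Gcl(2)[OF this t2[of j]] show ?thesis by (simp add: i smult_monom)
  next
    case False
    then obtain j where i: "i = Suc (2 * j)" by (auto elim: oddE)
    have "[:0, poly.coeff p i:] \<in> generate_ring ?P ?H"
      using p False by (intro generate_ring.incl) (auto simp: A_def)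
    from Gcl(2)[OF this t2[of j]] show ?thesis by (simp add: i smult_monom monom_Suc)
  qed
  show "A \<subseteq> generate_ring ?P ?H"
  proof
    fix p assume p: "p \<in> A"
    have "(\<Sum>i\<in>B. Polynomial.monom (poly.coeff p i) i) \<in> generate_ring ?P ?H" for B
      using mono[OF p] G01 Gcl(1) by (induction B rule: infinite_finite_induct) auto
    from this[of "{..Polynomial.degree p}"] show "p \<in> generate_ring ?P ?H"
      unfolding poly_as_sum_of_monoms .
  qed
qed

end

lemma mpoly_ring_eq:
  "mpoly_ring n = (ring_of_type_algebra :: 'k::comm_ring_1 mpoly ring)\<lparr>carrier := carrier (mpoly_ring n)\<rparr>"
  by (simp add: mpoly_ring_def)

lemma mpoly_ring_simps [simp]:
  "x \<otimes>\<^bsub>mpoly_ring n\<^esub> y = x * y" "x \<oplus>\<^bsub>mpoly_ring n\<^esub> y = x + y"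
  "\<one>\<^bsub>mpoly_ring n\<^esub> = 1" "\<zero>\<^bsub>mpoly_ring n\<^esub> = 0"
  by (simp_all add: mpoly_ring_def)

theorem theoremE:
  fixes n :: nat and I :: "'k::field mpoly set"
  assumes "CHAR('k) \<noteq> 2"
    and "ideal I (mpoly_ring n)"
    and "homogeneous_ideal n I"
  shows "(ideal_radical (mpoly_ring n) I = I \<longleftrightarrow> seminormal (Rees_like n I)) \<and>
         (seminormal (Rees_like n I) \<longleftrightarrow> weakly_normal (Rees_like n I))"
proof -
  let ?S = "carrier (mpoly_ring n) :: 'k mpoly set"
  interpret I: ideal I "mpoly_ring n" by (rule assms(2))
  have two: "(2::'k) \<noteq> 0"
  proof
    assume "(2::'k) = 0"
    then have "CHAR('k) dvd 2" using of_nat_eq_0_iff_char_dvd[where 'a = 'k, of 2] by simp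
    then have "CHAR('k) \<le> 2" "CHAR('k) \<noteq> 0"
      by (simp add: dvd_imp_le) (metis dvd_0_left_iff zero_neq_numeral \<open>CHAR('k) dvd 2\<close>)
    moreover have "CHAR('k) \<noteq> 1" by simp
    moreover have "c = 2" if "c \<le> 2" "c \<noteq> 0" "c \<noteq> 1" for c :: nat using that by linarith
    ultimately have "CHAR('k) = 2" by blast
    then show False using assms(1) by simp
  qed
  let ?h = "Poly_Mapping.single 0 (1 / 2) :: 'k mpoly"
  interpret rees_data ?S I ?h
  proof (rule rees_data.intro)
    show "subring ?S ring_of_type_algebra" by (rule subring_mpoly_ring)
    show "completely_integrally_closed ?S" by (rule completely_integrally_closed_mpoly_ring)
    show "I \<subseteq> ?S" by (rule I.a_subset)
    show "0 \<in> I" using I.idealE(1) by simp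
    show "\<And>x y. x \<in> I \<Longrightarrow> y \<in> I \<Longrightarrow> x + y \<in> I" using I.idealE(2) by simp
    show "\<And>r x. r \<in> ?S \<Longrightarrow> x \<in> I \<Longrightarrow> r * x \<in> I" using I.idealE(5) by simp
    show "?h \<in> ?S" by (simp add: mpoly_ring_def)
    show "?h * 2 = 1"
      using two by (simp add: mult_2_right flip: single_add)
  qed
  have rees: "Rees_like n I = ring_of_type_algebra\<lparr>carrier := A\<rparr>"
    unfolding Rees_like_def A_eq_generate_ring by (simp add: mpoly_ring_t_def polys_over_def)
  have "ideal_radical (mpoly_ring n) I = {g \<in> ?S. \<exists>m>0. g ^ m \<in> I}"
    unfolding ideal_radical_def by (subst (2) mpoly_ring_eq) (simp only: type_algebra_pow)
  then show ?thesis unfolding rees seminormal_iff_radical by simp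
qed

end
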